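(* For each fixed $q\ge 3$, the transition for $q$-colorability of a random graph has characteristic width at least $\Theta(\sqrt{n})$. That is, for every $\varepsilon\in(0,1/2)$ there is a constant $c>0$ (depending on $q$ and $\varepsilon$) such that $\Delta_\varepsilon(n)\ge c\sqrt{n}$ for all sufficiently large $n$.
   Context: The random graph on $n$ vertices with $m$ edges is obtained by selecting $m$ uniformly random edges from the $\binom{n}{2}$ possible edges, either without replacement or with replacement (in the latter case $q$-colorability is a property of the set of edges that occur). A graph is $q$-colorable if its vertices can be properly colored with $q$ colors. Characteristic width: for $0<r<1$ let $m_r(n)$ be the smallest $m$ for which the random graph on $n$ vertices with $m$ edges is $q$-colorable with probability $\le r$. For $0<\varepsilon<1/2$ the characteristic width is $\Delta_\varepsilon(n)=m_\varepsilon(n)-m_{1-\varepsilon}(n)$, i.e. the amount by which $m$ must be increased for the probability of $q$-colorability to drop from $1-\varepsilon$ to $\varepsilon$. *)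

theory Defs
  imports "HOL-Probability.Probability"
begin

text \<open>A graph on the vertex set \<open>{..<n}\<close> is given by its edge set, a subset of \<open>all_edges n\<close>.\<close>

definition all_edges :: "nat \<Rightarrow> nat set set" where
  "all_edges n = {e. e \<subseteq> {..<n} \<and> card e = 2}"

definition q_colorable :: "nat \<Rightarrow> nat \<Rightarrow> nat set set \<Rightarrow> bool" where
  "q_colorable q n E \<longleftrightarrow>
     (\<exists>c. (\<forall>v<n. c v < q) \<and> (\<forall>u v. {u, v} \<in> E \<longrightarrow> c u \<noteq> c v))"

text \<open>
  The distribution of the edge set of the random graph with \<open>n\<close> vertices and \<open>m\<close> edges.
  It is meaningful only for \<open>m \<le> n choose 2\<close> when drawing without replacement, and only for
  \<open>n \<ge> 2\<close> or \<open>m = 0\<close> when drawing with replacement; otherwise \<open>pmf_of_set\<close> is applied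
  to the empty set and the result is unspecified.
\<close>

definition random_graph_without_replacement :: "nat \<Rightarrow> nat \<Rightarrow> nat set set pmf" where
  "random_graph_without_replacement n m = pmf_of_set {E. E \<subseteq> all_edges n \<and> card E = m}"

definition random_graph_with_replacement :: "nat \<Rightarrow> nat \<Rightarrow> nat set set pmf" where
  "random_graph_with_replacement n m =
     map_pmf set (replicate_pmf m (pmf_of_set (all_edges n)))"

definition prob_colorable :: "(nat \<Rightarrow> nat \<Rightarrow> nat set set pmf) \<Rightarrow> nat \<Rightarrow> nat \<Rightarrow> nat \<Rightarrow> real" where
  "prob_colorable G q n m = measure_pmf.prob (G n m) {E. q_colorable q n E}"

text \<open>
  In both models, for \<open>q \<ge> 1\<close>, \<open>n > q\<close> and \<open>0 < r < 1\<close> the least element below exists.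
  Without replacement it is at most \<open>n choose 2\<close>, since the complete graph on more than
  \<open>q\<close> vertices is not \<open>q\<close>-colorable, so the unspecified distributions play no role.
\<close>

definition colorability_threshold ::
    "(nat \<Rightarrow> nat \<Rightarrow> nat set set pmf) \<Rightarrow> nat \<Rightarrow> real \<Rightarrow> nat \<Rightarrow> nat" where
  "colorability_threshold G q r n = (LEAST m. prob_colorable G q n m \<le> r)"

definition characteristic_width ::
    "(nat \<Rightarrow> nat \<Rightarrow> nat set set pmf) \<Rightarrow> nat \<Rightarrow> real \<Rightarrow> nat \<Rightarrow> real" where
  "characteristic_width G q \<epsilon> n =
     real (colorability_threshold G q \<epsilon> n) - real (colorability_threshold G q (1 - \<epsilon>) n)"

end

theory Submission
  imports Defs
begin

text \<open>
  An edge that meets no other edge is irrelevant for \<open>q\<close>-colorability when \<open>q \<ge> 2\<close>. Deleting such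
  an edge from a graph with \<open>m + 1\<close> edges gives a graph with \<open>m\<close> edges together with a pair of
  vertices that meets none of them. Let \<open>I\<close> be the number of isolated edges and \<open>F\<close> the number
  of free pairs, and write \<open>N\<close> for \<open>n choose 2\<close>. Double counting compares the two distributions
  through a likelihood ratio of at least \<open>((m + 1) / N) * F / (I + 1)\<close>, so the probability \<open>p m\<close> of colorability satisfies
  \<open>p m - p (m + 1) \<le> E (1 - X / Y)\<^sup>+\<close> with \<open>X = F / N\<close> and \<open>Y = (I + 1) / (m + 1)\<close>. Both \<open>X\<close>
  and \<open>Y\<close> have second moment \<open>O(1 / n)\<close> around the same number, which is bounded below for \<open>m = O(n)\<close>;
  hence \<open>p\<close> drops by \<open>O(1 / sqrt n)\<close> per step. The first moment method shows that the
  thresholds lie in this linear range, so \<open>p\<close> needs order \<open>sqrt n\<close> steps to fall from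
  \<open>1 - \<epsilon>\<close> to \<open>\<epsilon>\<close>.
\<close>

section \<open>Edge sequences and isolated edges\<close>

text \<open>Both models are uniform distributions on sequences: \<open>r\<close> tells whether repetitions are allowed
  (drawing with replacement).\<close>

definition edge_lists :: "bool \<Rightarrow> 'a set \<Rightarrow> nat \<Rightarrow> 'a list set" where
  "edge_lists r A m = {xs. set xs \<subseteq> A \<and> length xs = m \<and> (r \<or> distinct xs)}"

text \<open>For \<open>r\<close> this is a power of \<open>M\<close>, otherwise a falling factorial;
  real arguments avoid truncated subtraction in the ratios.\<close>

definition falling :: "bool \<Rightarrow> real \<Rightarrow> nat \<Rightarrow> real" where
  "falling r M m = (\<Prod>i<m. M - (if r then 0 else real i))"

lemma finite_edge_lists: "finite A \<Longrightarrow> finite (edge_lists r A m)"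
  by (rule finite_subset[OF _ finite_lists_length_eq[of A m]]) (auto simp: edge_lists_def)

lemma edge_lists_0 [simp]: "edge_lists r A 0 = {[]}"
  by (auto simp: edge_lists_def)

lemma edge_lists_Suc:
  "edge_lists r A (Suc m) =
    (\<lambda>(xs, x). x # xs) ` (SIGMA xs:edge_lists r A m. A - (if r then {} else set xs))"
proof (rule set_eqI)
  fix ys
  show "ys \<in> edge_lists r A (Suc m) \<longleftrightarrow>
    ys \<in> (\<lambda>(xs, x). x # xs) ` (SIGMA xs:edge_lists r A m. A - (if r then {} else set xs))"
    by (cases ys) (auto simp: edge_lists_def image_iff)
qed

lemma card_edge_lists:
  assumes "finite A"
  shows "real (card (edge_lists r A m)) = falling r (real (card A)) m"
proof (induction m)
  case 0
  then show ?case by (simp add: falling_def)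
next
  case (Suc m)
  have "card (A - (if r then {} else set xs)) = card A - (if r then 0 else m)"
    if "xs \<in> edge_lists r A m" for xs
    using that assms by (auto simp: edge_lists_def card_Diff_subset distinct_card)
  then have "card (edge_lists r A (Suc m)) =
      card (edge_lists r A m) * (card A - (if r then 0 else m))"
    unfolding edge_lists_Suc using assms
    by (subst card_image) (auto simp: inj_on_def card_SigmaI finite_edge_lists)
  \<comment> \<open>Truncated subtraction agrees with the real factor only for
    \<open>m \<le> card A\<close>; if no list of length \<open>m\<close> exists, both sides are 0
    already.\<close>
  moreover have "m \<le> card A" if "card (edge_lists r A m) \<noteq> 0" "\<not> r"
  proof -
    from that obtain xs where "xs \<in> edge_lists r A m" by fastforce
    with that assms show ?thesis
      by (metis (mono_tags, lifting) card_mono distinct_card edge_lists_def mem_Collect_eq)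
  qed
  ultimately show ?case
    using Suc by (cases "card (edge_lists r A m) = 0") (auto simp: falling_def of_nat_diff)
qed

text \<open>A nonempty entry always meets itself, so it is isolated iff it meets exactly one entry.\<close>

definition isolated_count :: "'a set list \<Rightarrow> nat" where
  "isolated_count xs = length (filter (\<lambda>x. length (filter (\<lambda>y. x \<inter> y \<noteq> {}) xs) = 1) xs)"

definition free_edges :: "'a set set \<Rightarrow> 'a set list \<Rightarrow> 'a set set" where
  "free_edges A xs = {e \<in> A. \<forall>x\<in>set xs. e \<inter> x = {}}"

definition avoiding :: "'a set set \<Rightarrow> 'a set \<Rightarrow> 'a set set" where
  "avoiding A e = {x \<in> A. e \<inter> x = {}}"

text \<open>The new edge is isolated itself and meets no other entry, so the status of the others
  does not change.\<close>

lemma isolated_count_insert: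
  assumes "e \<noteq> {}" "\<forall>x\<in>set (xs @ ys). e \<inter> x = {}"
  shows "isolated_count (xs @ e # ys) = isolated_count (xs @ ys) + 1"
proof -
  have n: "filter (\<lambda>y. e \<inter> y \<noteq> {}) xs = []" "filter (\<lambda>y. e \<inter> y \<noteq> {}) ys = []"
    using assms by (auto simp: filter_empty_conv)
  have "filter (\<lambda>x. length (filter (\<lambda>y. x \<inter> y \<noteq> {}) (xs @ e # ys)) = 1) zs =
      filter (\<lambda>x. length (filter (\<lambda>y. x \<inter> y \<noteq> {}) (xs @ ys)) = 1) zs"
    if "set zs \<subseteq> set (xs @ ys)" for zs
    using assms that by (intro filter_cong refl) (auto simp: Int_commute)
  from this[of xs] this[of ys] show ?thesis
    unfolding isolated_count_def filter_append using n assms by simp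
qed

lemma isolated_at_iff:
  assumes "e \<noteq> {}"
  shows "length (filter (\<lambda>y. e \<inter> y \<noteq> {}) (xs @ e # ys)) = 1 \<longleftrightarrow> (\<forall>x\<in>set (xs @ ys). e \<inter> x = {})"
  using assms by (auto simp: filter_empty_conv)

text \<open>Double counting of pairs of a list of length \<open>m + 1\<close> and a position of an isolated edge in it:
  removing that edge leaves a list of length \<open>m\<close>, a position and a free edge.\<close>

lemma sum_isolated_count:
  fixes g G :: "'a set list \<Rightarrow> real"
  assumes "finite A" "{} \<notin> A"
    and g: "\<And>xs ys e. xs @ ys \<in> edge_lists r A m \<Longrightarrow> e \<in> free_edges A (xs @ ys) \<Longrightarrow>
      g (xs @ e # ys) = G (xs @ ys)"
  shows "(\<Sum>s\<in>edge_lists r A (Suc m). real (isolated_count s) * g s) =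
    (real m + 1) * (\<Sum>s\<in>edge_lists r A m. real (card (free_edges A s)) * G s)"
proof -
  define J where "J s = {i. i < length s \<and> length (filter (\<lambda>y. s ! i \<inter> y \<noteq> {}) s) = 1}"
    for s :: "'a set list"
  have J: "isolated_count s = card (J s)" for s
    unfolding isolated_count_def J_def by (rule length_filter_conv_card)
  have fin: "finite (J s)" for s by (simp add: J_def)
  have "(\<Sum>s\<in>edge_lists r A (Suc m). real (isolated_count s) * g s) =
      (\<Sum>s\<in>edge_lists r A (Suc m). \<Sum>i\<in>J s. g s)"
    by (simp add: J)
  also have "\<dots> = (\<Sum>(s, i)\<in>(SIGMA s:edge_lists r A (Suc m). J s). g s)"
    using fin finite_edge_lists[OF assms(1)] by (intro sum.Sigma) auto
  also have "\<dots> = (\<Sum>(s, i, e)\<in>(SIGMA s:edge_lists r A m. {..m} \<times> free_edges A s). G s)"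
  proof (rule sum.reindex_bij_witness[where
        i = "\<lambda>(s, i, e). (take i s @ e # drop i s, i)" and
        j = "\<lambda>(s, i). (take i s @ drop (Suc i) s, i, s ! i)"])
    fix a assume a: "a \<in> (SIGMA s:edge_lists r A (Suc m). J s)"
    obtain s i where si: "a = (s, i)" by (cases a)
    have s: "s \<in> edge_lists r A (Suc m)" and i: "i < length s"
      and iso: "length (filter (\<lambda>y. s ! i \<inter> y \<noteq> {}) s) = 1"
      using a by (auto simp: si J_def)
    define xs ys e where d: "xs = take i s" "ys = drop (Suc i) s" "e = s ! i"
    have dec: "s = xs @ e # ys" using i d by (simp add: id_take_nth_drop)
    have len: "length xs = i" "i \<le> m" "length (xs @ ys) = m"
      using s i by (auto simp: d edge_lists_def)
    have e: "e \<in> A" using s dec by (auto simp: edge_lists_def)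
    then have "e \<noteq> {}" using assms by auto
    have "length (filter (\<lambda>y. e \<inter> y \<noteq> {}) (xs @ e # ys)) = 1"
      using iso unfolding dec[symmetric] unfolding d(3) .
    with isolated_at_iff[OF \<open>e \<noteq> {}\<close>] have free: "\<forall>x\<in>set (xs @ ys). e \<inter> x = {}"
      by (rule iffD1)
    have mem: "xs @ ys \<in> edge_lists r A m"
      using s len dec by (auto simp: edge_lists_def)
    have ja: "(case a of (s, i) \<Rightarrow> (take i s @ drop (Suc i) s, i, s ! i)) = (xs @ ys, i, e)"
      by (simp add: si d)
    show "(case case a of (s, i) \<Rightarrow> (take i s @ drop (Suc i) s, i, s ! i) of
        (s, i, e) \<Rightarrow> (take i s @ e # drop i s, i)) = a"
      unfolding ja using len dec si by simp
    show "(case a of (s, i) \<Rightarrow> (take i s @ drop (Suc i) s, i, s ! i)) \<in>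
        (SIGMA s:edge_lists r A m. {..m} \<times> free_edges A s)"
      unfolding ja using mem len free e by (auto simp: free_edges_def)
    have "g s = G (xs @ ys)"
      unfolding dec using mem free e by (intro g) (auto simp: free_edges_def)
    then show "(case case a of (s, i) \<Rightarrow> (take i s @ drop (Suc i) s, i, s ! i) of
        (s, i, e) \<Rightarrow> G s) = (case a of (s, i) \<Rightarrow> g s)"
      unfolding ja by (simp add: si)
  next
    fix b assume b: "b \<in> (SIGMA s:edge_lists r A m. {..m} \<times> free_edges A s)"
    obtain s i e where sie: "b = (s, i, e)" by (cases b)
    have s: "s \<in> edge_lists r A m" "i \<le> m" "e \<in> A" "\<forall>x\<in>set s. e \<inter> x = {}"
      using b by (auto simp: sie free_edges_def)
    define xs ys where d: "xs = take i s" "ys = drop i s"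
    have dec: "s = xs @ ys" by (simp add: d)
    have len: "length xs = i" "length (xs @ ys) = m" using s by (auto simp: d edge_lists_def)
    have e: "e \<noteq> {}" using s assms by auto
    \<comment> \<open>A nonempty edge disjoint from all entries differs from them, so its insertion
      keeps a list distinct.\<close>
    then have "e \<notin> set s" using s by auto
    then have mem: "xs @ e # ys \<in> edge_lists r A (Suc m)"
      using s len dec by (auto simp: edge_lists_def)
    have ib: "(case b of (s, i, e) \<Rightarrow> (take i s @ e # drop i s, i)) = (xs @ e # ys, i)"
      by (simp add: sie d)
    have nth: "(xs @ e # ys) ! i = e" using len by (simp add: nth_append)
    show "(case case b of (s, i, e) \<Rightarrow> (take i s @ e # drop i s, i) of
        (s, i) \<Rightarrow> (take i s @ drop (Suc i) s, i, s ! i)) = b"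
      unfolding ib using len dec sie nth by simp
    have "i \<in> J (xs @ e # ys)"
      unfolding J_def mem_Collect_eq nth isolated_at_iff[OF e] using s len dec by auto
    then show "(case b of (s, i, e) \<Rightarrow> (take i s @ e # drop i s, i)) \<in>
        (SIGMA s:edge_lists r A (Suc m). J s)"
      unfolding ib using mem by auto
  qed
  also have "\<dots> = (\<Sum>s\<in>edge_lists r A m. \<Sum>(i, e)\<in>{..m} \<times> free_edges A s. G s)"
    using finite_edge_lists[OF assms(1)] assms(1)
    by (subst sum.Sigma) (auto simp: free_edges_def)
  also have "\<dots> = (real m + 1) * (\<Sum>s\<in>edge_lists r A m. real (card (free_edges A s)) * G s)"
    by (simp add: sum_distrib_left card_cartesian_product algebra_simps)
  finally show ?thesis .
qed

text \<open>Exchange of summation: \<open>e\<close> is free for \<open>s\<close> exactly when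
  \<open>s\<close> is a list over \<open>avoiding A e\<close>. Moments of free edges thus reduce to
  sums over lists from smaller edge sets.\<close>

lemma sum_free_edges:
  fixes G :: "'a set list \<Rightarrow> real"
  assumes "finite A"
  shows "(\<Sum>s\<in>edge_lists r A m. real (card (free_edges A s)) * G s) =
    (\<Sum>e\<in>A. \<Sum>s\<in>edge_lists r (avoiding A e) m. G s)"
proof -
  have "(\<Sum>s\<in>edge_lists r A m. real (card (free_edges A s)) * G s) =
      (\<Sum>s\<in>edge_lists r A m. \<Sum>e\<in>free_edges A s. G s)" by simp
  also have "\<dots> = (\<Sum>s\<in>edge_lists r A m. \<Sum>e\<in>{e\<in>A. \<forall>x\<in>set s. e \<inter> x = {}}. G s)"
    by (simp add: free_edges_def)
  also have "\<dots> = (\<Sum>e\<in>A. \<Sum>s\<in>{s\<in>edge_lists r A m. \<forall>x\<in>set s. e \<inter> x = {}}. G s)"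
    using assms by (intro sum.swap_restrict) (auto simp: finite_edge_lists)
  also have "\<dots> = (\<Sum>e\<in>A. \<Sum>s\<in>edge_lists r (avoiding A e) m. G s)"
    by (intro sum.cong refl) (auto simp: edge_lists_def avoiding_def)
  finally show ?thesis .
qed

section \<open>Moments of the numbers of isolated and free edges\<close>

lemma falling_0 [simp]: "falling r M 0 = 1"
  by (simp add: falling_def)

lemma falling_Suc: "falling r M (Suc m) = falling r M m * (M - (if r then 0 else real m))"
  by (simp add: falling_def)

lemma falling_pos: "real m \<le> M \<Longrightarrow> M > 0 \<Longrightarrow> falling r M m > 0"
  unfolding falling_def by (intro prod_pos) auto

lemma falling_mono: "real m \<le> M \<Longrightarrow> M \<le> N \<Longrightarrow> falling r M m \<le> falling r N m"
  unfolding falling_def by (intro prod_mono) auto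

text \<open>Holds factor by factor: on expanding, one hypothesis compares the constant terms and the
  other the terms linear in the shift \<open>d\<close>. It yields negative correlation of two
  disjoint edges being free.\<close>

lemma falling_log_concave:
  assumes "real m \<le> M" "M \<le> N" "M * N \<le> L\<^sup>2" "2 * L \<le> M + N"
  shows "falling r M m * falling r N m \<le> (falling r L m)\<^sup>2"
proof -
  have "falling r M m * falling r N m =
      (\<Prod>i<m. (M - (if r then 0 else real i)) * (N - (if r then 0 else real i)))"
    by (simp add: falling_def prod.distrib)
  also have "\<dots> \<le> (\<Prod>i<m. (L - (if r then 0 else real i))\<^sup>2)"
  proof (intro prod_mono conjI)
    fix i assume i: "i \<in> {..<m}"
    define d where "d = (if r then 0 else real i)"
    have d: "0 \<le> d" "d \<le> M" using i assms by (auto simp: d_def)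
    then have "d * (2 * L) \<le> d * (M + N)" using assms(4) by (intro mult_left_mono) auto
    then have "(M - d) * (N - d) \<le> (L - d)\<^sup>2"
      using assms(3) by (simp add: power2_eq_square algebra_simps)
    then show "(M - (if r then 0 else real i)) * (N - (if r then 0 else real i))
        \<le> (L - (if r then 0 else real i))\<^sup>2"
      by (simp only: d_def)
    show "0 \<le> (M - (if r then 0 else real i)) * (N - (if r then 0 else real i))"
      using d assms(2) by (simp only: d_def[symmetric]) simp
  qed
  also have "\<dots> = (falling r L m)\<^sup>2"
    by (simp add: falling_def prod_power_distrib)
  finally show ?thesis .
qed

text \<open>A further draw multiplies the ratio by \<open>1 - (N - M) / (N - d)\<close>, where
  \<open>d\<close> is 0 or \<open>m\<close>; since \<open>N - d \<ge> N - real m\<close>, one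
  \<delta> covers both models.\<close>

lemma falling_ratio_step:
  assumes "real (Suc m) \<le> M" "M \<le> N" "0 < M" "N - M \<le> \<delta> * (N - real m)" and \<delta>: "0 \<le> \<delta>"
  shows "falling r M (Suc m) / falling r N (Suc m) \<ge> falling r M m / falling r N m * (1 - \<delta>)"
    and "falling r M (Suc m) / falling r N (Suc m) \<le> falling r M m / falling r N m"
proof -
  define d where "d = (if r then 0 else real m)"
  have d: "0 \<le> d" "d \<le> real m" "d < M" using assms by (auto simp: d_def)
  have pos: "falling r M m > 0" "falling r N m > 0"
    using assms by (auto intro!: falling_pos)
  have "N - M \<le> \<delta> * (N - d)"
    using assms(4) mult_left_mono[OF d(2) \<delta>] by (simp add: algebra_simps)
  then have "(M - d) / (N - d) \<ge> 1 - \<delta>" "(M - d) / (N - d) \<le> 1"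
    using d assms by (simp_all add: field_simps)
  moreover have "falling r M (Suc m) / falling r N (Suc m) =
      falling r M m / falling r N m * ((M - d) / (N - d))"
    by (simp add: falling_Suc d_def)
  moreover have "falling r M m / falling r N m \<ge> 0" using pos by simp
  ultimately show "falling r M (Suc m) / falling r N (Suc m) \<ge> falling r M m / falling r N m * (1 - \<delta>)"
    "falling r M (Suc m) / falling r N (Suc m) \<le> falling r M m / falling r N m"
    by (metis mult_left_mono, metis mult_left_le)
qed

text \<open>If \<open>M\<close> of \<open>N\<close> edges avoid a fixed edge, the ratio is the
  probability that \<open>m\<close> draws all avoid it. A \<delta> valid at \<open>m\<close> is
  valid at all earlier draws.\<close>

lemma falling_ratio_bounds:
  assumes "real m \<le> M" "M \<le> N" "0 < M" "N - M \<le> \<delta> * (N - real m)" "\<delta> \<le> 1" and \<delta>: "0 \<le> \<delta>"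
  shows "falling r M m / falling r N m \<ge> (1 - \<delta>) ^ m"
    and "falling r M m / falling r N m \<le> 1"
proof -
  have pos: "falling r M m > 0" "falling r N m > 0"
    using assms by (auto intro!: falling_pos)
  show "falling r M m / falling r N m \<le> 1"
    using falling_mono[OF assms(1,2)] pos by simp
  have "(1 - \<delta>) ^ k \<le> falling r M k / falling r N k" if "k \<le> m" for k
    using that
  proof (induction k)
    case (Suc k)
    have "\<delta> * (N - real m) \<le> \<delta> * (N - real k)"
      using Suc.prems \<delta> by (intro mult_left_mono) auto
    then have "falling r M k / falling r N k * (1 - \<delta>) \<le> falling r M (Suc k) / falling r N (Suc k)"
      using assms Suc.prems by (intro falling_ratio_step) auto
    moreover have "(1 - \<delta>) ^ k * (1 - \<delta>) \<le> falling r M k / falling r N k * (1 - \<delta>)"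
      using Suc assms by (intro mult_right_mono) auto
    ultimately show ?case by (simp add: mult.commute)
  qed simp
  then show "falling r M m / falling r N m \<ge> (1 - \<delta>) ^ m" by simp
qed

section \<open>Moments in an abstract edge system\<close>

text \<open>First and second moments see the complete graph only through three counts: all edges,
  those avoiding one edge, and those avoiding two disjoint edges.\<close>

locale edge_system =
  fixes A :: "'a set set" and N M1 M2 :: nat
  assumes finite_edges: "finite A" and nonempty_edges: "{} \<notin> A"
    and card_edges: "card A = N"
    and card_avoiding: "e \<in> A \<Longrightarrow> card (avoiding A e) = M1"
    and card_avoiding2: "e \<in> A \<Longrightarrow> e' \<in> avoiding A e \<Longrightarrow> card (avoiding (avoiding A e) e') = M2"
begin

lemma finite_avoiding: "finite (avoiding A e)" "finite (avoiding (avoiding A e) e')"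
  using finite_edges by (auto simp: avoiding_def)

lemma nonempty_avoiding: "{} \<notin> avoiding A e"
  using nonempty_edges by (auto simp: avoiding_def)

lemma sum_free:
  "(\<Sum>s\<in>edge_lists r A m. real (card (free_edges A s))) = real N * falling r M1 m"
  using sum_free_edges[OF finite_edges, where G = "\<lambda>_. 1" and r = r and m = m]
  by (simp add: card_edge_lists finite_avoiding card_avoiding card_edges)

lemma sum_free_avoiding:
  assumes "e \<in> A"
  shows "(\<Sum>s\<in>edge_lists r (avoiding A e) m. real (card (free_edges (avoiding A e) s)))
    = real M1 * falling r M2 m"
  using sum_free_edges[OF finite_avoiding(1), where G = "\<lambda>_. 1" and r = r and m = m] assms
  by (simp add: card_edge_lists finite_avoiding card_avoiding card_avoiding2)

lemma sum_isolated:
  "(\<Sum>s\<in>edge_lists r A (Suc m). real (isolated_count s)) = (real m + 1) * (real N * falling r M1 m)"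
  using sum_isolated_count[OF finite_edges nonempty_edges, where g = "\<lambda>_. 1" and G = "\<lambda>_. 1" and r = r and m = m]
  by (simp add: sum_free)

text \<open>Fixing the free edge leaves lists over the edges avoiding it, where the first moment of
  isolated edges involves \<open>M2\<close>. At \<open>m = 0\<close> the truncated
  \<open>m - 1\<close> is multiplied by 0.\<close>

lemma sum_free_isolated:
  "(\<Sum>s\<in>edge_lists r A m. real (card (free_edges A s)) * real (isolated_count s))
    = real m * (real N * (real M1 * falling r M2 (m - 1)))"
proof (cases m)
  case 0
  then show ?thesis by (simp add: isolated_count_def)
next
  case (Suc k)
  have "(\<Sum>s\<in>edge_lists r (avoiding A e) (Suc k). real (isolated_count s)) =
      (real k + 1) * (real M1 * falling r M2 k)" if "e \<in> A" for e
    using sum_isolated_count[OF finite_avoiding(1) nonempty_avoiding,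
        where g = "\<lambda>_. 1" and G = "\<lambda>_. 1" and r = r and m = k] that
    by (simp add: sum_free_avoiding)
  then show ?thesis
    by (simp add: sum_free_edges[OF finite_edges] Suc card_edges)
qed

text \<open>Removing an isolated edge uses up one factor of the square; in the other factor the
  removed edge accounts for a \<open>+ 1\<close>. What remains is a mixed and a first
  moment.\<close>

lemma sum_isolated_square:
  "(\<Sum>s\<in>edge_lists r A (Suc m). (real (isolated_count s))\<^sup>2) =
    (real m + 1) * (real m * (real N * (real M1 * falling r M2 (m - 1))) + real N * falling r M1 m)"
proof -
  have "(\<Sum>s\<in>edge_lists r A (Suc m). real (isolated_count s) * real (isolated_count s)) =
    (real m + 1) * (\<Sum>s\<in>edge_lists r A m. real (card (free_edges A s)) * (real (isolated_count s) + 1))"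
  proof (rule sum_isolated_count[OF finite_edges nonempty_edges])
    fix xs ys e assume "e \<in> free_edges A (xs @ ys)"
    then show "real (isolated_count (xs @ e # ys)) = real (isolated_count (xs @ ys)) + 1"
      using nonempty_edges by (subst isolated_count_insert) (auto simp: free_edges_def)
  qed
  then show ?thesis
    by (simp add: power2_eq_square distrib_left sum.distrib sum_free sum_free_isolated)
qed

text \<open>Given a free edge \<open>e\<close>, the free edges disjoint from it are summed exactly
  through \<open>M2\<close>, and at most \<open>N - M1\<close> edges meet it.\<close>

lemma sum_free_square:
  "(\<Sum>s\<in>edge_lists r A m. (real (card (free_edges A s)))\<^sup>2) \<le>
    real N * (real M1 * falling r M2 m + (real N - real M1) * falling r M1 m)"
proof -
  have "(\<Sum>s\<in>edge_lists r A m. (real (card (free_edges A s)))\<^sup>2) =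
      (\<Sum>e\<in>A. \<Sum>s\<in>edge_lists r (avoiding A e) m. real (card (free_edges A s)))"
    using sum_free_edges[OF finite_edges, where G = "\<lambda>s. real (card (free_edges A s))"]
    by (simp add: power2_eq_square)
  also have "\<dots> \<le> (\<Sum>e\<in>A. \<Sum>s\<in>edge_lists r (avoiding A e) m.
      real (card (free_edges (avoiding A e) s)) + (real N - real M1))"
  proof (intro sum_mono)
    fix e s assume e: "e \<in> A"
    have "free_edges A s \<subseteq> free_edges (avoiding A e) s \<union> (A - avoiding A e)"
      by (auto simp: free_edges_def avoiding_def)
    moreover have "finite (free_edges (avoiding A e) s \<union> (A - avoiding A e))"
      using finite_edges by (auto simp: free_edges_def avoiding_def)
    ultimately have "card (free_edges A s) \<le> card (free_edges (avoiding A e) s \<union> (A - avoiding A e))"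
      by (rule card_mono[rotated])
    also have "\<dots> \<le> card (free_edges (avoiding A e) s) + card (A - avoiding A e)"
      by (rule card_Un_le)
    also have "card (A - avoiding A e) = card A - card (avoiding A e)"
      using finite_avoiding(1) by (intro card_Diff_subset) (auto simp: avoiding_def)
    finally have "card (free_edges A s) \<le> card (free_edges (avoiding A e) s) + (N - M1)"
      using e by (simp add: card_edges card_avoiding)
    moreover have "M1 \<le> N"
      using card_mono[OF finite_edges, of "avoiding A e"] card_avoiding[OF e] card_edges
      by (auto simp: avoiding_def)
    ultimately show "real (card (free_edges A s)) \<le>
        real (card (free_edges (avoiding A e) s)) + (real N - real M1)"
      by linarith
  qed
  also have "\<dots> = (\<Sum>e\<in>A. real M1 * falling r M2 m + (real N - real M1) * falling r M1 m)"
    by (intro sum.cong refl)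
      (simp add: sum.distrib sum_free_avoiding card_edge_lists finite_avoiding card_avoiding)
  also have "\<dots> = real N * (real M1 * falling r M2 m + (real N - real M1) * falling r M1 m)"
    by (simp add: card_edges)
  finally show ?thesis .
qed

end

section \<open>One-step decrease of an invariant probability\<close>

context edge_system
begin

text \<open>Here \<delta> bounds the relative loss per draw of \<open>falling r M1\<close> against
  \<open>falling r N\<close>, and \<tau> the error of replacing \<open>N - m\<close> by
  \<open>N\<close> twice. For the complete graph with \<open>m = O(n)\<close> both can be taken
  \<open>O(1 / n)\<close>.\<close>

context
  fixes r :: bool and m :: nat and \<delta> \<tau> :: real
  assumes m: "Suc m \<le> M2" and M: "M2 \<le> M1" "M1 \<le> N"
    and log_concave: "real M2 * real N \<le> (real M1)\<^sup>2" "2 * real M1 \<le> real M2 + real N"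
    and \<delta>: "real N - real M1 \<le> \<delta> * (real N - real m)" "\<delta> \<le> 1"
    and \<tau>: "(real N)\<^sup>2 \<le> (1 + \<tau>) * (real N - real m)\<^sup>2" "\<tau> \<ge> 0"
begin

text \<open>The probability that a fixed edge is free after \<open>k\<close> draws;
  \<open>lam m\<close> is the center of both deviations below.\<close>

abbreviation lam :: "nat \<Rightarrow> real" where
  "lam k \<equiv> falling r M1 k / falling r N k"

lemma delta_nonneg: "\<delta> \<ge> 0"
proof -
  have "real N - real m > 0" "real N - real M1 \<ge> 0" using m M by auto
  then show ?thesis using \<delta>(1) by (metis order.trans linorder_not_less zero_le_mult_iff)
qed

lemma delta_mono:
  assumes "k \<le> m"
  shows "real N - real M1 \<le> \<delta> * (real N - real k)"
  using \<delta>(1) mult_left_mono[of "real N - real m" "real N - real k" \<delta>] assms delta_nonneg by simp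

lemma total_pos: "k \<le> Suc m \<Longrightarrow> falling r N k > 0"
  using m M by (intro falling_pos) auto

lemma lam_bounds:
  assumes "k \<le> m"
  shows "lam k > 0" "lam k \<le> 1" "1 - lam k \<le> real k * \<delta>"
proof -
  show "lam k > 0" using assms m M by (auto intro!: divide_pos_pos falling_pos)
  have b: "lam k \<ge> (1 - \<delta>) ^ k" "lam k \<le> 1"
    using assms m M \<delta>(2) delta_nonneg by (auto intro!: falling_ratio_bounds delta_mono)
  show "lam k \<le> 1" by fact
  have "1 + real k * (-\<delta>) \<le> (1 + (-\<delta>)) ^ k"
    using \<delta>(2) by (intro Bernoulli_inequality) auto
  with b show "1 - lam k \<le> real k * \<delta>" by simp
qed

text \<open>Removing isolated edges leads to \<open>m - 1\<close> and \<open>m - 2\<close> draws;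
  this compares the resulting probabilities with \<open>lam m\<close>.\<close>

lemma lam_Suc:
  assumes "Suc k \<le> m"
  shows "lam (Suc k) \<ge> lam k - \<delta>" "lam (Suc k) \<le> lam k"
proof -
  have "lam (Suc k) \<ge> lam k * (1 - \<delta>)" and le: "lam (Suc k) \<le> lam k"
    using assms m M delta_mono[of k] delta_nonneg
    by (auto intro!: falling_ratio_step simp del: times_divide_eq_left)
  moreover have "lam k * \<delta> \<le> \<delta>"
    using lam_bounds[of k] assms delta_nonneg by (intro mult_left_le_one_le) auto
  ultimately show "lam (Suc k) \<ge> lam k - \<delta>" unfolding right_diff_distrib by linarith
  show "lam (Suc k) \<le> lam k" by fact
qed

text \<open>Negative correlation: two disjoint edges are both free with at most the probability they
  would have if independent.\<close>

lemma second_ratio: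
  assumes "k \<le> m"
  shows "falling r M2 k / falling r N k \<le> (lam k)\<^sup>2"
proof -
  have "falling r M2 k * falling r N k \<le> (falling r M1 k)\<^sup>2"
    using assms m M log_concave by (intro falling_log_concave) auto
  then show ?thesis using total_pos[of k] assms
    by (simp add: power_divide divide_le_eq power2_eq_square field_simps)
qed

text \<open>A variance bound, as the mean is exactly \<open>lam m\<close>. Disjoint pairs contribute
  no positive covariance by \<open>second_ratio\<close>; the others form a fraction
  \<open>1 - M1 / N \<le> \<delta>\<close>.\<close>

lemma free_deviation:
  "(\<Sum>s\<in>edge_lists r A m. (real (card (free_edges A s)) / real N - lam m)\<^sup>2) / falling r N m \<le> \<delta>"
proof -
  define T where "T = falling r N m"
  define l where "l = lam m"
  have T: "T > 0" using total_pos[of m] by (simp add: T_def)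
  have N: "real N > 0" using m M by auto
  have "(\<Sum>s\<in>edge_lists r A m. (real (card (free_edges A s)) / real N - l)\<^sup>2) =
      (\<Sum>s\<in>edge_lists r A m. (real (card (free_edges A s)))\<^sup>2) / (real N)\<^sup>2
      - 2 * l / real N * (\<Sum>s\<in>edge_lists r A m. real (card (free_edges A s)))
      + l\<^sup>2 * real (card (edge_lists r A m))"
    by (simp add: power2_diff sum.distrib sum_subtractf sum_distrib_left sum_divide_distrib
        power_divide algebra_simps)
  also have "\<dots> = (\<Sum>s\<in>edge_lists r A m. (real (card (free_edges A s)))\<^sup>2) / (real N)\<^sup>2 - l\<^sup>2 * T"
    using N T by (simp add: sum_free card_edge_lists finite_edges card_edges T_def[symmetric])
       (simp add: l_def T_def[symmetric] field_simps power2_eq_square)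
  also have "\<dots> \<le> real N * (real M1 * falling r M2 m + (real N - real M1) * falling r M1 m) / (real N)\<^sup>2 - l\<^sup>2 * T"
    by (intro diff_right_mono divide_right_mono sum_free_square) auto
  also have "\<dots> = T * (real M1 / N * (falling r M2 m / T) + (1 - real M1 / N) * l - l\<^sup>2)"
    using N T by (simp add: l_def T_def[symmetric] field_simps power2_eq_square)
  also have "\<dots> \<le> T * (real M1 / N * l\<^sup>2 + (1 - real M1 / N) * l - l\<^sup>2)"
    using second_ratio[of m] T by (intro mult_left_mono diff_right_mono add_right_mono)
      (auto simp: T_def l_def)
  also have "\<dots> = T * ((1 - real M1 / N) * (l - l\<^sup>2))"
    by (simp add: algebra_simps)
  also have "\<dots> \<le> T * ((1 - real M1 / N) * 1)"
  proof -
    have "l \<le> 1" using lam_bounds[of m] by (simp add: l_def)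
    then have "l - l\<^sup>2 \<le> 1" using zero_le_power2[of l] by linarith
    then show ?thesis using T M N by (intro mult_left_mono) auto
  qed
  also have "\<dots> \<le> T * \<delta>"
    using T N delta_mono[of 0] by (intro mult_left_mono) (auto simp: field_simps)
  finally show ?thesis using T by (simp add: T_def l_def divide_le_eq mult.commute)
qed

text \<open>The center is only close to the mean. The expanded square therefore needs a lower bound
  of the mean for the negative cross term and an upper bound of the second moment.\<close>

lemma isolated_square_deviation:
  "(\<Sum>s\<in>edge_lists r A m. (real (isolated_count s) - real m * lam m)\<^sup>2) / falling r N m
    \<le> (real m)\<^sup>2 * (6 * \<tau> + 6 * \<delta>)"
proof (cases m)
  case 0
  then show ?thesis by (simp add: isolated_count_def)
next
  case (Suc k)
  define T where "T = falling r N m"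
  define \<mu> where "\<mu> = lam m"
  define d where "d i = (if r then 0 else real i)" for i
  have T: "T > 0" using total_pos[of m] by (simp add: T_def)
  have Nm: "real N - real m > 0" using m M by auto
  have N: "real N > 0" using m M by auto
  have dm: "0 \<le> d i" "d i \<le> real m" if "i \<le> m" for i using that by (auto simp: d_def)
  have \<mu>: "0 < \<mu>" "\<mu> \<le> 1" "1 - \<mu> \<le> real m * \<delta>" using lam_bounds[of m] by (auto simp: \<mu>_def)
  have Tk: "T = falling r N k * (N - d k)" by (simp add: T_def Suc falling_Suc d_def)
  have Tk0: "falling r N k > 0" using total_pos[of k] Suc by simp
  have kpos: "N - d k > 0" using dm[of k] Nm Suc by simp
  define E1 where "E1 = (\<Sum>s\<in>edge_lists r A m. real (isolated_count s)) / T"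
  define E2 where "E2 = (\<Sum>s\<in>edge_lists r A m. (real (isolated_count s))\<^sup>2) / T"
  \<comment> \<open>A ratio of at least 1 is at most its square, so the hypothesis on \<tau> also
    bounds a single factor.\<close>
  have sq: "N / (N - d i) \<le> 1 + \<tau>" "N / (N - d i) \<ge> 1" if "i \<le> m" for i
  proof -
    have "N / (N - d i) \<le> N / (N - real m)"
      using dm[OF that] Nm by (intro divide_left_mono) (auto simp: zero_less_mult_iff)
    also have "\<dots> \<le> (N / (N - real m))\<^sup>2"
      using Nm by (intro self_le_power) auto
    also have "\<dots> \<le> 1 + \<tau>"
      using \<tau>(1) Nm by (simp add: power_divide divide_le_eq)
    finally show "N / (N - d i) \<le> 1 + \<tau>" .
    show "N / (N - d i) \<ge> 1" using dm[OF that] Nm by simp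
  qed
  \<comment> \<open>Removing the isolated edge leaves \<open>k = m - 1\<close> draws;
    \<open>N / (N - d k)\<close> makes up for the last factor of \<open>T\<close>.\<close>
  have E1: "E1 = real m * (N / (N - d k)) * lam k"
    unfolding E1_def Tk unfolding Suc sum_isolated using Tk0 kpos by (simp add: field_simps)
  have "E1 \<ge> real m * 1 * \<mu>"
    unfolding E1 \<mu>_def using sq(2)[of k] lam_Suc(2)[of k] Suc lam_bounds(1)[of m] lam_bounds(1)[of k]
    by (intro mult_mono mult_nonneg_nonneg) auto
  then have E1_lower: "E1 \<ge> real m * \<mu>" by simp
  have "E1 \<le> real m * (1 + \<tau>) * 1"
    unfolding E1 using sq(1)[of k] lam_bounds[of k] Suc N kpos \<tau>(2)
    by (intro mult_mono mult_nonneg_nonneg) auto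
  then have E1_upper: "E1 \<le> real m * (1 + \<tau>)" by simp
  \<comment> \<open>The second term counts ordered pairs of distinct isolated edges, hence
    \<open>M2\<close> and two draws fewer.\<close>
  have E2: "E2 = E1 + real m * (real k * (N * (M1 * falling r M2 (k - 1)))) / T"
    unfolding E1_def E2_def unfolding Suc sum_isolated_square sum_isolated
    by (simp add: algebra_simps add_divide_distrib)
  have "real m * (real k * (N * (M1 * falling r M2 (k - 1)))) / T
      \<le> real m * real k * ((1 + \<tau>) * (\<mu>\<^sup>2 + 4 * \<delta>))"
  proof (cases k)
    case 0
    then show ?thesis by simp
  next
    case (Suc j)
    have j: "m = Suc (Suc j)" using Suc \<open>m = Suc k\<close> by simp
    have jpos: "N - d j > 0" using dm[of j] Nm j by simp
    have Tj0: "falling r N j > 0" using total_pos[of j] j by simp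
    have "T = falling r N j * (N - d j) * (N - d k)" by (simp add: Tk Suc falling_Suc d_def)
    then have "real m * (real k * (N * (M1 * falling r M2 (k - 1)))) / T =
        real m * real k * ((N * M1 / ((N - d j) * (N - d k))) * (falling r M2 j / falling r N j))"
      by (simp add: Suc mult_ac)
    also have "\<dots> \<le> real m * real k * ((1 + \<tau>) * (\<mu>\<^sup>2 + 4 * \<delta>))"
    proof (intro mult_left_mono[of _ _ "real m * real k"] mult_mono)
      have "N * M1 / ((N - d j) * (N - d k)) \<le> N * N / ((N - real m) * (N - real m))"
        using dm[of j] dm[of k] j \<open>m = Suc k\<close> Nm M by (intro frac_le mult_mono mult_pos_pos) auto
      also have "\<dots> \<le> 1 + \<tau>"
        using \<tau>(1) Nm by (simp add: divide_le_eq power2_eq_square)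
      finally show "N * M1 / ((N - d j) * (N - d k)) \<le> 1 + \<tau>" .
      \<comment> \<open>Two draws separate \<open>j\<close> from \<open>m\<close>, hence
        \<open>2 * \<delta>\<close>; as both values are at most 1, their squares differ by at most
        \<open>4 * \<delta>\<close>.\<close>
      have l: "\<mu> \<le> lam j" "lam j \<le> \<mu> + 2 * \<delta>" "lam j \<le> 1"
        using lam_Suc[of j] lam_Suc[of k] j Suc lam_bounds[of j] unfolding \<mu>_def by auto
      then have "(lam j - \<mu>) * (lam j + \<mu>) \<le> (2 * \<delta>) * 2"
        using \<mu> delta_nonneg by (intro mult_mono) auto
      then have "(lam j)\<^sup>2 \<le> \<mu>\<^sup>2 + 4 * \<delta>" by (simp add: power2_eq_square algebra_simps)
      then show "falling r M2 j / falling r N j \<le> \<mu>\<^sup>2 + 4 * \<delta>"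
        using second_ratio[of j] j by linarith
      show "0 \<le> falling r M2 j / falling r N j"
        using Tj0 j m falling_pos[of j M2 r] by (simp add: less_imp_le)
    qed (use \<tau>(2) in auto)
    finally show ?thesis .
  qed
  moreover have mk: "real m * real k = (real m)\<^sup>2 - real m" by (simp add: Suc power2_eq_square algebra_simps)
  moreover have "real m * real k * ((1 + \<tau>) * (\<mu>\<^sup>2 + 4 * \<delta>))
      \<le> ((real m)\<^sup>2 - real m) * \<mu>\<^sup>2 + (real m)\<^sup>2 * (4 * \<delta> + \<tau> * 5)"
  proof -
    \<comment> \<open>The coefficient 5 of \<tau> is the crude bound of
      \<open>\<mu>\<^sup>2 + 4 * \<delta>\<close>.\<close>
    have "\<mu>\<^sup>2 \<le> 1" using \<mu> by (simp add: power_le_one)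
    then have "\<tau> * (\<mu>\<^sup>2 + 4 * \<delta>) \<le> \<tau> * 5"
      using \<tau>(2) \<delta>(2) by (intro mult_left_mono) auto
    then have "(1 + \<tau>) * (\<mu>\<^sup>2 + 4 * \<delta>) \<le> \<mu>\<^sup>2 + (4 * \<delta> + \<tau> * 5)" by (simp add: algebra_simps)
    then have "real m * real k * ((1 + \<tau>) * (\<mu>\<^sup>2 + 4 * \<delta>))
        \<le> real m * real k * \<mu>\<^sup>2 + real m * real k * (4 * \<delta> + \<tau> * 5)"
      unfolding distrib_left[symmetric] by (intro mult_left_mono) auto
    also have "real m * real k * (4 * \<delta> + \<tau> * 5) \<le> (real m)\<^sup>2 * (4 * \<delta> + \<tau> * 5)"
      using Suc \<tau>(2) delta_nonneg by (intro mult_right_mono) (auto simp: power2_eq_square)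
    finally show ?thesis by (simp add: mk)
  qed
  ultimately have E2_upper: "E2 \<le> E1 + ((real m)\<^sup>2 - real m) * \<mu>\<^sup>2 + (real m)\<^sup>2 * (4 * \<delta> + \<tau> * 5)"
    unfolding E2 by linarith
  have "(\<Sum>s\<in>edge_lists r A m. (real (isolated_count s) - real m * \<mu>)\<^sup>2) / T
      = E2 - 2 * real m * \<mu> * E1 + (real m)\<^sup>2 * \<mu>\<^sup>2"
  proof -
    have "(\<Sum>s\<in>edge_lists r A m. (real (isolated_count s) - real m * \<mu>)\<^sup>2) =
      (\<Sum>s\<in>edge_lists r A m. (real (isolated_count s))\<^sup>2)
      - 2 * real m * \<mu> * (\<Sum>s\<in>edge_lists r A m. real (isolated_count s))
      + (real m)\<^sup>2 * \<mu>\<^sup>2 * real (card (edge_lists r A m))"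
      by (simp add: power2_diff sum.distrib sum_subtractf sum_distrib_left
        power_mult_distrib algebra_simps)
    then show ?thesis using T
      by (simp add: E1_def E2_def card_edge_lists finite_edges card_edges T_def[symmetric]
          add_divide_distrib diff_divide_distrib)
  qed
  also have "\<dots> \<le> E2 - 2 * real m * \<mu> * (real m * \<mu>) + (real m)\<^sup>2 * \<mu>\<^sup>2"
    using E1_lower \<mu> by (intro add_right_mono diff_left_mono mult_left_mono) auto
  also have "\<dots> \<le> real m * (1 + \<tau>) - real m * \<mu>\<^sup>2 + (real m)\<^sup>2 * (4 * \<delta> + \<tau> * 5)"
    using E2_upper E1_upper by (simp add: power2_eq_square algebra_simps)
  \<comment> \<open>Terms linear in \<open>m\<close> are absorbed:
    \<open>1 - \<mu> \<le> real m * \<delta>\<close> supplies the second factor \<open>m\<close> and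
    adds \<open>2 * \<delta>\<close>, while \<open>m \<ge> 1\<close> handles
    \<open>real m * \<tau>\<close>.\<close>
  also have "\<dots> \<le> (real m)\<^sup>2 * (6 * \<tau> + 6 * \<delta>)"
  proof -
    have "(1 - \<mu>) * (1 + \<mu>) \<le> (real m * \<delta>) * 2"
      using \<mu> delta_nonneg by (intro mult_mono) auto
    then have "real m * (1 - \<mu>\<^sup>2) \<le> real m * (real m * \<delta> * 2)"
      by (intro mult_left_mono) (auto simp: power2_eq_square algebra_simps)
    moreover have "real m * \<tau> \<le> (real m)\<^sup>2 * \<tau>"
      using \<tau>(2) Suc by (intro mult_right_mono) (auto simp: power2_eq_square)
    ultimately show ?thesis by (simp add: power2_eq_square algebra_simps)
  qed
  finally show ?thesis by (simp add: T_def \<mu>_def)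
qed

text \<open>The shift by 1 turns the previous deviation \<open>x\<close> into
  \<open>x + (1 - l)\<close>. Splitting the square costs a factor 2, and
  \<open>(1 - l)\<^sup>2 \<le> 1 - l \<le> real m * \<delta>\<close> adds one more \<delta>.\<close>

lemma isolated_deviation:
  "(\<Sum>s\<in>edge_lists r A m. ((real (isolated_count s) + 1) / (real m + 1) - lam m)\<^sup>2) / falling r N m
    \<le> 12 * \<tau> + 14 * \<delta>"
proof -
  define T where "T = falling r N m"
  define l where "l = lam m"
  have T: "T > 0" using total_pos[of m] by (simp add: T_def)
  have l: "0 < l" "l \<le> 1" "1 - l \<le> real m * \<delta>" using lam_bounds[of m] by (auto simp: l_def)
  have "((real (isolated_count s) + 1) / (real m + 1) - l)\<^sup>2
      \<le> 2 / (real m + 1)\<^sup>2 * ((real (isolated_count s) - real m * l)\<^sup>2 + real m * \<delta>)" for s :: "'a set list"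
  proof -
    define x where "x = real (isolated_count s) - real m * l"
    have "(1 - l)\<^sup>2 \<le> 1 - l" using l by (simp add: power2_eq_square mult_left_le_one_le)
    moreover have "(x + (1 - l))\<^sup>2 \<le> 2 * (x\<^sup>2 + (1 - l)\<^sup>2)"
      using sum_squares_bound[of x "1 - l"] by (simp add: power2_sum)
    ultimately have *: "(x + (1 - l))\<^sup>2 \<le> 2 * (x\<^sup>2 + real m * \<delta>)"
      using l(3) by (meson add_left_mono mult_left_mono order_trans zero_le_numeral)
    have "(real (isolated_count s) + 1) / (real m + 1) - l = (x + (1 - l)) / (real m + 1)"
      by (simp add: x_def field_simps)
    then have "((real (isolated_count s) + 1) / (real m + 1) - l)\<^sup>2 = (x + (1 - l))\<^sup>2 / (real m + 1)\<^sup>2"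
      by (simp add: power_divide)
    also have "\<dots> \<le> 2 * (x\<^sup>2 + real m * \<delta>) / (real m + 1)\<^sup>2"
      by (intro divide_right_mono *) auto
    finally show ?thesis by (simp add: x_def)
  qed
  then have "(\<Sum>s\<in>edge_lists r A m. ((real (isolated_count s) + 1) / (real m + 1) - l)\<^sup>2)
    \<le> (\<Sum>s\<in>edge_lists r A m. 2 / (real m + 1)\<^sup>2 * ((real (isolated_count s) - real m * l)\<^sup>2 + real m * \<delta>))"
    by (intro sum_mono)
  also have "\<dots> = 2 / (real m + 1)\<^sup>2 *
      ((\<Sum>s\<in>edge_lists r A m. (real (isolated_count s) - real m * l)\<^sup>2) + T * (real m * \<delta>))"
    by (simp only: sum_distrib_left[symmetric] sum.distrib sum_constant card_edge_lists[OF finite_edges]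
        card_edges T_def mult_ac)
  also have "\<dots> \<le> 2 / (real m + 1)\<^sup>2 * (T * ((real m)\<^sup>2 * (6 * \<tau> + 6 * \<delta>)) + T * (real m * \<delta>))"
  proof -
    have "(\<Sum>s\<in>edge_lists r A m. (real (isolated_count s) - real m * l)\<^sup>2) / T
        \<le> (real m)\<^sup>2 * (6 * \<tau> + 6 * \<delta>)"
      using isolated_square_deviation unfolding T_def l_def .
    then have "(\<Sum>s\<in>edge_lists r A m. (real (isolated_count s) - real m * l)\<^sup>2)
        \<le> T * ((real m)\<^sup>2 * (6 * \<tau> + 6 * \<delta>))"
      unfolding pos_divide_le_eq[OF T] by (simp only: mult.commute)
    then show ?thesis by (intro mult_left_mono add_right_mono) auto
  qed
  also have "\<dots> = T * (2 * (((real m)\<^sup>2 * (6 * \<tau> + 6 * \<delta>) + real m * \<delta>) / (real m + 1)\<^sup>2))"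
    by (simp add: field_simps)
  also have "\<dots> \<le> T * (2 * (6 * \<tau> + 7 * \<delta>))"
  proof -
    have "(real m)\<^sup>2 * (6 * \<tau> + 6 * \<delta>) \<le> (real m + 1)\<^sup>2 * (6 * \<tau> + 6 * \<delta>)"
      using \<tau>(2) delta_nonneg by (intro mult_right_mono power_mono) auto
    moreover have "real m * \<delta> \<le> (real m + 1)\<^sup>2 * \<delta>"
      using delta_nonneg by (intro mult_right_mono) (auto simp: power2_eq_square algebra_simps)
    ultimately have "(real m)\<^sup>2 * (6 * \<tau> + 6 * \<delta>) + real m * \<delta> \<le> (6 * \<tau> + 7 * \<delta>) * (real m + 1)\<^sup>2"
      by (simp add: algebra_simps)
    then show ?thesis using T by (intro mult_left_mono) (auto simp: divide_le_eq)
  qed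
  finally show ?thesis using T by (simp add: T_def l_def divide_le_eq algebra_simps)
qed

text \<open>The drop is at most the mean of \<open>c s * (1 - X s / Y s)\<close>, which the
  deviations of \<open>X\<close> and \<open>Y\<close> from \<open>lam m\<close> control. The free
  parameter \<open>t\<close> balances their second moments against \<open>2 / t\<close>.\<close>

lemma prob_step:
  fixes C :: "'a set list \<Rightarrow> bool" and t :: real
  assumes t: "t > 0"
    and C: "\<And>xs ys e. xs @ ys \<in> edge_lists r A m \<Longrightarrow> e \<in> free_edges A (xs @ ys) \<Longrightarrow>
      C (xs @ e # ys) \<longleftrightarrow> C (xs @ ys)"
  shows "(\<Sum>s\<in>edge_lists r A m. of_bool (C s)) / falling r N m
     - (\<Sum>s\<in>edge_lists r A (Suc m). of_bool (C s)) / falling r N (Suc m)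
     \<le> (t * (12 * \<tau> + 15 * \<delta>) + 2 / t) / lam m"
proof -
  define T where "T = falling r N m"
  define l where "l = lam m"
  have T: "T > 0" using total_pos[of m] by (simp add: T_def)
  have T1: "falling r N (Suc m) > 0" using total_pos[of "Suc m"] by simp
  have N: "real N > 0" using m M by auto
  have l: "0 < l" using lam_bounds[of m] by (auto simp: l_def)
  define X where "X s = real (card (free_edges A s)) / real N" for s
  define Y where "Y s = (real (isolated_count s) + 1) / (real m + 1)" for s :: "'a set list"
  define c where "c s = (of_bool (C s) :: real)" for s
  have Y: "Y s > 0" for s by (simp add: Y_def add_nonneg_pos)
  have X: "X s \<ge> 0" for s by (simp add: X_def)
  have c: "c s \<ge> 0" "c s \<le> 1" for s by (auto simp: c_def)
  \<comment> \<open>Dividing by the number of isolated edges makes each list with property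
    \<open>C\<close> count once in total, or not at all if it has none, because
    \<open>c s / 0 = 0\<close>.\<close>
  have "(\<Sum>s\<in>edge_lists r A (Suc m). real (isolated_count s) * (c s / real (isolated_count s))) =
    (real m + 1) * (\<Sum>s\<in>edge_lists r A m.
      real (card (free_edges A s)) * (c s / (real (isolated_count s) + 1)))"
  proof (rule sum_isolated_count[OF finite_edges nonempty_edges])
    fix xs ys e assume "xs @ ys \<in> edge_lists r A m" and e: "e \<in> free_edges A (xs @ ys)"
    then have "c (xs @ e # ys) = c (xs @ ys)" using C by (simp add: c_def)
    moreover have "isolated_count (xs @ e # ys) = isolated_count (xs @ ys) + 1"
      using e nonempty_edges by (intro isolated_count_insert) (auto simp: free_edges_def)
    ultimately show "c (xs @ e # ys) / real (isolated_count (xs @ e # ys)) =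
        c (xs @ ys) / (real (isolated_count (xs @ ys)) + 1)" by (simp add: add.commute)
  qed
  also have "\<dots> = real N * (\<Sum>s\<in>edge_lists r A m. c s * (X s / Y s))"
    unfolding sum_distrib_left using N by (intro sum.cong refl) (simp add: X_def Y_def)
  finally have "real N * (\<Sum>s\<in>edge_lists r A m. c s * (X s / Y s)) =
    (\<Sum>s\<in>edge_lists r A (Suc m). real (isolated_count s) * (c s / real (isolated_count s)))" ..
  also have "\<dots> \<le> (\<Sum>s\<in>edge_lists r A (Suc m). c s)"
    using c by (intro sum_mono) auto
  finally have lower: "real N * (\<Sum>s\<in>edge_lists r A m. c s * (X s / Y s)) \<le> (\<Sum>s\<in>edge_lists r A (Suc m). c s)" .
  have "(\<Sum>s\<in>edge_lists r A m. c s * (X s / Y s)) / T \<le> (\<Sum>s\<in>edge_lists r A (Suc m). c s) / (T * real N)"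
    using lower T N by (simp add: field_simps)
  also have "\<dots> \<le> (\<Sum>s\<in>edge_lists r A (Suc m). c s) / falling r N (Suc m)"
  proof (intro divide_left_mono)
    \<comment> \<open>The last draw has \<open>N\<close> or \<open>N - m\<close> choices, so the
      factor \<open>N\<close> only enlarges the denominator.\<close>
    show "falling r N (Suc m) \<le> T * real N" using T by (auto simp: falling_Suc T_def)
    show "0 \<le> (\<Sum>s\<in>edge_lists r A (Suc m). c s)" using c by (intro sum_nonneg) auto
    show "0 < T * real N * falling r N (Suc m)" using T T1 N by simp
  qed
  finally have "(\<Sum>s\<in>edge_lists r A m. c s) / T - (\<Sum>s\<in>edge_lists r A (Suc m). c s) / falling r N (Suc m)
    \<le> (\<Sum>s\<in>edge_lists r A m. c s * (1 - X s / Y s)) / T"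
    by (simp add: right_diff_distrib sum_subtractf diff_divide_distrib)
  also have "\<dots> \<le> (\<Sum>s\<in>edge_lists r A m. (t * ((Y s - l)\<^sup>2 + (X s - l)\<^sup>2) + 2 / t) / l) / T"
  proof (intro divide_right_mono sum_mono)
    fix s
    \<comment> \<open>Trades absolute deviations for the squared ones bounded above.\<close>
    have am_gm: "2 * \<bar>x\<bar> \<le> t * x\<^sup>2 + 1 / t" for x :: real
    proof -
      have "0 \<le> (t * \<bar>x\<bar> - 1)\<^sup>2 / t" using t by simp
      then show ?thesis using t by (simp add: power2_eq_square field_simps)
    qed
    have "c s * (1 - X s / Y s) * l \<le> 2 * (\<bar>Y s - l\<bar> + \<bar>X s - l\<bar>)"
    \<comment> \<open>If \<open>Y s\<close> is at least \<open>l / 2\<close>, dividing by it costs a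
      factor 2 against \<open>l\<close>; otherwise \<open>Y s\<close> misses \<open>l\<close> by
      more than \<open>l / 2\<close>, and the trivial bound 1 suffices.\<close>
    proof (cases "Y s \<ge> l / 2")
      case True
      have "c s * (1 - X s / Y s) \<le> \<bar>Y s - X s\<bar> / Y s"
      proof -
        have "1 - X s / Y s = (Y s - X s) / Y s" using Y[of s] by (simp add: diff_divide_distrib)
        also have "\<dots> \<le> \<bar>Y s - X s\<bar> / Y s" using Y[of s] by (intro divide_right_mono) auto
        finally show ?thesis using Y[of s] by (simp add: c_def)
      qed
      also have "\<dots> \<le> \<bar>Y s - X s\<bar> / (l / 2)"
        using True l Y[of s] by (intro divide_left_mono) auto
      finally have "c s * (1 - X s / Y s) * l \<le> \<bar>Y s - X s\<bar> / (l / 2) * l"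
        using l by (intro mult_right_mono) auto
      also have "\<dots> = 2 * \<bar>Y s - X s\<bar>" using l by simp
      also have "\<dots> \<le> 2 * (\<bar>Y s - l\<bar> + \<bar>X s - l\<bar>)"
        using abs_triangle_ineq4[of "Y s - l" "X s - l"] by simp
      finally show ?thesis .
    next
      case False
      have "X s / Y s \<ge> 0" using X[of s] Y[of s] by simp
      then have "c s * (1 - X s / Y s) \<le> 1" by (simp add: c_def)
      then have "c s * (1 - X s / Y s) * l \<le> 1 * l" using l by (intro mult_right_mono) auto
      also have "\<dots> \<le> 2 * \<bar>Y s - l\<bar>" using False l by (simp add: abs_if)
      also have "\<dots> \<le> 2 * (\<bar>Y s - l\<bar> + \<bar>X s - l\<bar>)" by simp
      finally show ?thesis .
    qed
    also have "\<dots> \<le> t * ((Y s - l)\<^sup>2 + (X s - l)\<^sup>2) + 2 / t"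
      using am_gm[of "Y s - l"] am_gm[of "X s - l"] by (simp add: algebra_simps)
    finally show "c s * (1 - X s / Y s) \<le> (t * ((Y s - l)\<^sup>2 + (X s - l)\<^sup>2) + 2 / t) / l"
      using l by (simp add: le_divide_eq)
  qed (use T in auto)
  also have "\<dots> = (t * ((\<Sum>s\<in>edge_lists r A m. (Y s - l)\<^sup>2) / T
      + (\<Sum>s\<in>edge_lists r A m. (X s - l)\<^sup>2) / T) + 2 / t) / l"
    using T l t by (simp add: sum_divide_distrib[symmetric] sum.distrib sum_distrib_left[symmetric]
        card_edge_lists finite_edges card_edges T_def[symmetric] field_simps)
  also have "\<dots> \<le> (t * (12 * \<tau> + 15 * \<delta>) + 2 / t) / l"
  proof -
    have "(\<Sum>s\<in>edge_lists r A m. (Y s - l)\<^sup>2) / T + (\<Sum>s\<in>edge_lists r A m. (X s - l)\<^sup>2) / T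
        \<le> 12 * \<tau> + 15 * \<delta>"
      using isolated_deviation free_deviation by (simp add: X_def Y_def T_def l_def)
    then show ?thesis using t l by (intro divide_right_mono add_right_mono mult_left_mono) auto
  qed
  finally show ?thesis by (simp only: c_def T_def l_def)
qed

end

end

section \<open>Colorability of random graphs\<close>

lemma real_choose_two: "real (n choose 2) = real n * (real n - 1) / 2"
proof (induction n)
  case (Suc n)
  have "Suc n choose 2 = n + (n choose 2)" by (simp add: numeral_2_eq_2)
  with Suc show ?case by (simp add: field_simps)
qed simp

lemma avoiding_all_edges:
  "avoiding {x. x \<subseteq> S \<and> card x = 2} e = {x. x \<subseteq> S - e \<and> card x = 2}"
  by (auto simp: avoiding_def)

lemma finite_all_edges: "finite (all_edges n)"
  unfolding all_edges_def by (rule finite_subset[of _ "Pow {..<n}"]) auto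

lemma card_all_edges: "card (all_edges n) = n choose 2"
  unfolding all_edges_def by (subst n_subsets) auto

text \<open>The edges avoiding a given edge form the complete graph on the remaining vertices, so
  each avoided edge removes two vertices.\<close>

lemma edge_system_all_edges:
  "edge_system (all_edges n) (n choose 2) ((n - 2) choose 2) ((n - 4) choose 2)"
proof
  show "finite (all_edges n)" by (rule finite_all_edges)
  show "{} \<notin> all_edges n" by (simp add: all_edges_def)
  show "card (all_edges n) = n choose 2" by (rule card_all_edges)
next
  fix e assume e: "e \<in> all_edges n"
  then have "finite e" by (auto simp: all_edges_def intro: card_ge_0_finite)
  then have card_e: "card ({..<n} - e) = n - 2" using e
    by (auto simp: all_edges_def card_Diff_subset)
  then show "card (avoiding (all_edges n) e) = (n - 2) choose 2"
    unfolding all_edges_def avoiding_all_edges by (subst n_subsets) auto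
  fix e' assume e': "e' \<in> avoiding (all_edges n) e"
  then have "finite e'" "e' \<subseteq> {..<n} - e" "card e' = 2"
    unfolding all_edges_def avoiding_all_edges by (auto intro: card_ge_0_finite)
  then have "card ({..<n} - e - e') = n - 4"
    using card_e by (subst card_Diff_subset) auto
  then show "card (avoiding (avoiding (all_edges n) e) e') = (n - 4) choose 2"
    unfolding all_edges_def avoiding_all_edges by (subst n_subsets) auto
qed

text \<open>The ends of \<open>e\<close> lie on no edge of \<open>E\<close>, so they can be
  recolored with 0 and 1.\<close>

lemma q_colorable_insert_free:
  assumes "q \<ge> 2" "e \<in> all_edges n" "\<forall>x\<in>E. e \<inter> x = {}"
  shows "q_colorable q n (insert e E) \<longleftrightarrow> q_colorable q n E"
proof
  show "q_colorable q n (insert e E) \<Longrightarrow> q_colorable q n E"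
    by (auto simp: q_colorable_def)
next
  assume "q_colorable q n E"
  then obtain c where c: "\<forall>v<n. c v < q" "\<And>u v. {u, v} \<in> E \<Longrightarrow> c u \<noteq> c v"
    by (auto simp: q_colorable_def)
  obtain a b where e: "e = {a, b}" "a \<noteq> b"
    using assms(2) by (auto simp: all_edges_def card_2_iff)
  have "(c(a := 0, b := 1)) u \<noteq> (c(a := 0, b := 1)) v" if "{u, v} \<in> insert e E" for u v
  proof (cases "{u, v} = e")
    case True
    then show ?thesis using e by (auto simp: doubleton_eq_iff)
  next
    case False
    then have "{u, v} \<in> E" using that by auto
    moreover have "e \<inter> {u, v} = {}" using assms(3) \<open>{u, v} \<in> E\<close> by blast
    ultimately show ?thesis using c(2) e by auto
  qed
  moreover have "\<forall>v<n. (c(a := 0, b := 1)) v < q" using c(1) assms(1) by auto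
  ultimately show "q_colorable q n (insert e E)" unfolding q_colorable_def by blast
qed

text \<open>A common form for both models: colorability depends on a sequence only through its
  entries, and the denominator is the number of sequences.\<close>

definition list_prob :: "bool \<Rightarrow> nat \<Rightarrow> nat \<Rightarrow> nat \<Rightarrow> real" where
  "list_prob r q n m = (\<Sum>s\<in>edge_lists r (all_edges n) m. of_bool (q_colorable q n (set s)))
     / falling r (real (n choose 2)) m"

section \<open>One-step bound for linearly many edges\<close>

lemma exp_le_one_minus:
  fixes x :: real
  assumes "0 \<le> x" "x \<le> 1 / 2"
  shows "exp (- (2 * x)) \<le> 1 - x"
proof -
  have "x * (2 * x) \<le> x * 1" using assms by (intro mult_left_mono) auto
  then have "2 * x\<^sup>2 \<le> x" by (simp add: power2_eq_square)
  then have "- (2 * x) \<le> ln (1 - x)" using ln_one_minus_pos_lower_bound[OF assms] by linarith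
  then show ?thesis using assms by (simp add: ln_ge_iff)
qed

text \<open>With \<delta> and \<tau> of order \<open>1 / n\<close>, the choice
  \<open>t = sqrt n\<close> makes both terms of \<open>prob_step\<close> of order
  \<open>1 / sqrt n\<close>, while \<open>lam m\<close> stays above \<open>exp (- 16 * K)\<close>.
  The constants are \<open>12 * 12 * K + 15 * 8 + 2\<close>.\<close>

lemma list_prob_step:
  assumes q: "q \<ge> 2" and K: "K \<ge> 1" and n: "100 * K \<le> n" and m: "m \<le> K * n"
  shows "list_prob r q n m - list_prob r q n (Suc m)
    \<le> (144 * real K + 122) * exp (16 * real K) / sqrt (real n)"
proof -
  interpret edge_system "all_edges n" "n choose 2" "(n - 2) choose 2" "(n - 4) choose 2"
    by (rule edge_system_all_edges)
  define x where "x = real n"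
  define k where "k = real K"
  have k: "k \<ge> 1" using K by (simp add: k_def)
  have x: "x \<ge> 100 * k" using of_nat_mono[OF n, where ?'a = real] by (simp add: x_def k_def)
  have x100: "x \<ge> 100" using x k by simp
  then have n100: "n \<ge> 100" by (simp add: x_def)
  have mx: "real m \<le> k * x" using of_nat_mono[OF m, where ?'a = real] by (simp add: x_def k_def)
  have N: "real (n choose 2) = x * (x - 1) / 2"
    "real ((n - 2) choose 2) = (x - 2) * (x - 3) / 2"
    "real ((n - 4) choose 2) = (x - 4) * (x - 5) / 2"
    using n100 by (simp_all add: real_choose_two x_def of_nat_diff)
  \<comment> \<open>Only \<open>2 * x - 3\<close> edges meet a fixed edge, and
    \<open>x * x / 4\<close> bounds the undrawn edges from below, which gives \<delta>. For \<tau>,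
    \<open>m\<close> is at most \<open>u = 4 * k / x\<close> times the undrawn edges, and
    \<open>(1 + u)\<^sup>2 \<le> 1 + 3 * u\<close>.\<close>
  define \<delta> where "\<delta> = 8 / x"
  define \<tau> where "\<tau> = 12 * k / x"
  have xx: "100 * k * x \<le> x * x" using x x100 by (intro mult_right_mono) auto
  have kx: "x \<le> k * x" using k x100 by simp
  have quarter: "real (n choose 2) - real m \<ge> x * x / 4"
    using mx xx kx by (simp add: N field_simps)
  have big: "Suc m \<le> (n - 4) choose 2"
  proof -
    have "real (Suc m) \<le> real ((n - 4) choose 2)"
    proof -
      have "(x - 4) * (x - 5) = x * x - 9 * x + 20" by (simp add: algebra_simps)
      moreover have "2 * real m + 2 \<le> x * x - 9 * x + 20" using mx xx kx x100 by linarith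
      ultimately show ?thesis unfolding N by simp
    qed
    then show ?thesis by (simp only: of_nat_le_iff)
  qed
  have \<delta>: "real (n choose 2) - real ((n - 2) choose 2) \<le> \<delta> * (real (n choose 2) - real m)"
  proof -
    have "\<delta> * (x * x / 4) \<le> \<delta> * (real (n choose 2) - real m)"
      using quarter x100 by (intro mult_left_mono) (auto simp: \<delta>_def)
    moreover have "\<delta> * (x * x / 4) = 2 * x" using x100 by (simp add: \<delta>_def)
    moreover have "real (n choose 2) - real ((n - 2) choose 2) = 2 * x - 3" by (simp add: N field_simps)
    ultimately show ?thesis by linarith
  qed
  have \<delta>01: "0 \<le> \<delta>" "\<delta> \<le> 1 / 2" using x100 by (auto simp: \<delta>_def field_simps)
  have \<tau>: "(real (n choose 2))\<^sup>2 \<le> (1 + \<tau>) * (real (n choose 2) - real m)\<^sup>2"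
  proof -
    define u where "u = 4 * k / x"
    have u: "0 \<le> u" "u \<le> 1" using x x100 k by (auto simp: u_def field_simps)
    have "u * (x * x / 4) \<le> u * (real (n choose 2) - real m)"
      using quarter u by (intro mult_left_mono) auto
    moreover have "u * (x * x / 4) = k * x" using x100 by (simp add: u_def)
    ultimately have "real m \<le> u * (real (n choose 2) - real m)"
      using mx by linarith
    then have "real (n choose 2) \<le> (1 + u) * (real (n choose 2) - real m)"
      by (simp only: distrib_right) simp
    then have "(real (n choose 2))\<^sup>2 \<le> ((1 + u) * (real (n choose 2) - real m))\<^sup>2"
      by (intro power_mono) auto
    also have "\<dots> = (1 + u)\<^sup>2 * (real (n choose 2) - real m)\<^sup>2" by (simp add: power_mult_distrib)
    also have "\<dots> \<le> (1 + \<tau>) * (real (n choose 2) - real m)\<^sup>2"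
    proof (intro mult_right_mono)
      have "u * u \<le> u" using u by (simp add: mult_left_le_one_le)
      moreover have "\<tau> = 3 * u" by (simp add: \<tau>_def u_def)
      ultimately show "(1 + u)\<^sup>2 \<le> 1 + \<tau>" by (simp add: power2_eq_square algebra_simps)
    qed auto
    finally show ?thesis .
  qed
  have log_concave: "real ((n - 4) choose 2) * real (n choose 2) \<le> (real ((n - 2) choose 2))\<^sup>2"
  proof -
    \<comment> \<open>The four factors pair up symmetrically around \<open>x - 2\<close> and
      \<open>x - 3\<close>.\<close>
    have "(x - 4) * x \<le> (x - 2)\<^sup>2" "(x - 5) * (x - 1) \<le> (x - 3)\<^sup>2"
      by (simp_all add: power2_eq_square algebra_simps)
    then have "(x - 4) * x * ((x - 5) * (x - 1)) \<le> (x - 2)\<^sup>2 * (x - 3)\<^sup>2"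
      using x100 by (intro mult_mono) auto
    then show ?thesis by (simp add: N power2_eq_square mult_ac)
  qed
  have M: "(n - 4) choose 2 \<le> (n - 2) choose 2" "(n - 2) choose 2 \<le> n choose 2"
    by (auto intro!: binomial_right_mono)
  define l where "l = falling r (real ((n - 2) choose 2)) m / falling r (real (n choose 2)) m"
  have "(1 - \<delta>) ^ m \<le> l"
    unfolding l_def using big M \<delta> \<delta>01 n100 by (intro falling_ratio_bounds) auto
  moreover have "exp (- (16 * k)) \<le> (1 - \<delta>) ^ m"
  proof -
    have "2 * \<delta> * real m \<le> 2 * \<delta> * (k * x)" using mx \<delta>01 by (intro mult_left_mono) auto
    also have "\<dots> = 16 * k" using x100 by (simp add: \<delta>_def)
    finally have "exp (- (16 * k)) \<le> exp (real m * (- (2 * \<delta>)))" by (simp add: mult_ac)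
    also have "\<dots> = exp (- (2 * \<delta>)) ^ m" by (rule exp_of_nat_mult)
    also have "\<dots> \<le> (1 - \<delta>) ^ m" using exp_le_one_minus[OF \<delta>01] by (intro power_mono) auto
    finally show ?thesis .
  qed
  ultimately have l: "exp (- (16 * k)) \<le> l" by linarith
  have "list_prob r q n m - list_prob r q n (Suc m) \<le> (sqrt x * (12 * \<tau> + 15 * \<delta>) + 2 / sqrt x) / l"
    unfolding list_prob_def l_def
  proof (rule prob_step[OF big M log_concave _ \<delta> _ \<tau>])
    show "2 * real ((n - 2) choose 2) \<le> real ((n - 4) choose 2) + real (n choose 2)"
      by (simp add: N field_simps)
    show "\<delta> \<le> 1" using \<delta>01 by simp
    show "0 \<le> \<tau>" using k x100 by (simp add: \<tau>_def)
    show "0 < sqrt x" using x100 by simp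
  next
    fix xs ys e assume "e \<in> free_edges (all_edges n) (xs @ ys)"
    then have "q_colorable q n (insert e (set (xs @ ys))) \<longleftrightarrow> q_colorable q n (set (xs @ ys))"
      using q by (intro q_colorable_insert_free) (auto simp: free_edges_def)
    then show "q_colorable q n (set (xs @ e # ys)) = q_colorable q n (set (xs @ ys))" by simp
  qed
  also have "sqrt x * (12 * \<tau> + 15 * \<delta>) + 2 / sqrt x = (144 * k + 122) / sqrt x"
  proof -
    have "sqrt x * (12 * \<tau> + 15 * \<delta>) = sqrt x * ((144 * k + 120) / (sqrt x * sqrt x))"
      using x100 by (simp add: \<tau>_def \<delta>_def add_divide_distrib)
    also have "\<dots> = (144 * k + 120) / sqrt x"
    proof -
      have "s * (c / (s * s)) = c / s" if "s > 0" for s c :: real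
        using that by simp
      from this[of "sqrt x" "144 * k + 120"] show ?thesis using x100 by (simp del: real_sqrt_mult_self)
    qed
    finally show ?thesis by (simp add: add_divide_distrib[symmetric])
  qed
  also have "(144 * k + 122) / sqrt x / l \<le> (144 * k + 122) / sqrt x / exp (- (16 * k))"
    using l k x100 less_le_trans[OF exp_gt_zero l] by (intro divide_left_mono) auto
  also have "\<dots> = (144 * k + 122) * exp (16 * k) / sqrt x"
    by (simp add: exp_minus field_simps)
  finally show ?thesis by (simp add: k_def x_def)
qed

section \<open>First moment bound for colorability\<close>

text \<open>Each factor satisfies \<open>B - d \<le> B / N * (N - d)\<close>. As
  \<open>B - d\<close> may be negative, the products are assumed nonnegative, which holds when they
  count sequences.\<close>

lemma falling_le_power:
  assumes "real m \<le> N" "0 \<le> B" "B \<le> N" "\<And>k. falling r B k \<ge> 0"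
  shows "falling r B m \<le> (B / N) ^ m * falling r N m"
  using assms(1)
proof (induction m)
  case (Suc m)
  define d where "d = (if r then 0 else real m)"
  have N: "0 < N" "0 \<le> d" "d \<le> N" using Suc.prems by (auto simp: d_def)
  have "d * B \<le> d * N" using N assms by (intro mult_left_mono) auto
  then have *: "B - d \<le> B / N * (N - d)"
    using N by (simp add: field_simps)
  have "falling r B (Suc m) \<le> falling r B m * (B / N * (N - d))"
    unfolding falling_Suc d_def[symmetric] using * assms(4) by (intro mult_left_mono) auto
  also have "\<dots> \<le> (B / N) ^ m * falling r N m * (B / N * (N - d))"
    using Suc N assms by (intro mult_right_mono) auto
  also have "\<dots> = (B / N) ^ Suc m * falling r N (Suc m)"
    by (simp add: falling_Suc d_def)
  finally show ?case .
qed simp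

text \<open>By the pigeonhole principle some color class has at least \<open>x = n / q\<close>
  vertices, and all pairs inside it qualify. From \<open>x \<ge> 2\<close> follows
  \<open>x - 1 \<ge> x / 2\<close>, where the factor 2 is lost.\<close>

lemma card_monochromatic:
  assumes q: "q \<ge> 1" and n: "n \<ge> 2 * q" and c: "c \<in> {..<n} \<rightarrow> {..<q}"
  shows "real (card {e \<in> all_edges n. \<exists>u v. e = {u, v} \<and> c u = c v}) \<ge> real (n choose 2) / (2 * (real q)\<^sup>2)"
proof -
  obtain i where "card (c -` {i} \<inter> {..<n}) * card {..<q} \<ge> card {..<n}"
    using pigeonhole_card[OF c] q by (auto simp: lessThan_empty_iff)
  define S where "S = c -` {i} \<inter> {..<n}"
  define k where "k = real (card S)"
  have "real n \<le> real (card S * q)"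
    using \<open>card (c -` {i} \<inter> {..<n}) * card {..<q} \<ge> card {..<n}\<close> by (simp only: S_def card_lessThan of_nat_le_iff)
  then have k: "real n / real q \<le> k" using q by (simp add: k_def field_simps)
  define x where "x = real n / real q"
  have x: "x \<ge> 2" using of_nat_mono[OF n, where ?'a = real] q by (simp add: x_def field_simps)
  have "real (n choose 2) \<le> real n * real n / 2" by (simp add: real_choose_two algebra_simps)
  then have "real (n choose 2) / (2 * (real q)\<^sup>2) \<le> (real n * real n / 2) / (2 * (real q)\<^sup>2)"
    by (rule divide_right_mono) auto
  also have "\<dots> = x * (x / 2) / 2" by (simp add: x_def power2_eq_square)
  also have "\<dots> \<le> k * (k - 1) / 2"
    using k x unfolding x_def[symmetric] by (intro divide_right_mono mult_mono) auto
  also have "\<dots> = real (card {e. e \<subseteq> S \<and> card e = 2})"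
    by (subst n_subsets) (auto simp: S_def k_def real_choose_two)
  also have "\<dots> \<le> real (card {e \<in> all_edges n. \<exists>u v. e = {u, v} \<and> c u = c v})"
  proof (intro of_nat_mono card_mono subsetI)
    show "finite {e \<in> all_edges n. \<exists>u v. e = {u, v} \<and> c u = c v}" using finite_all_edges by auto
    fix e assume "e \<in> {e. e \<subseteq> S \<and> card e = 2}"
    then show "e \<in> {e \<in> all_edges n. \<exists>u v. e = {u, v} \<and> c u = c v}"
      by (auto simp: all_edges_def S_def card_2_iff)
  qed
  finally show ?thesis .
qed

text \<open>Union bound over the \<open>q ^ n\<close> colorings: one of them is proper only if all
  draws avoid its monochromatic edges, which make up at least the fraction \<gamma>.\<close>

lemma list_prob_first_moment:
  assumes q: "q \<ge> 1" and n: "n \<ge> 2 * q" and m: "m \<le> n choose 2"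
  shows "list_prob r q n m \<le> real q ^ n * (1 - 1 / (2 * (real q)\<^sup>2)) ^ m"
proof -
  define N where "N = n choose 2"
  define \<gamma> where "\<gamma> = 1 / (2 * (real q)\<^sup>2)"
  have N: "N > 0" using n q by (simp add: N_def zero_less_binomial)
  have cardN: "card (all_edges n) = N" by (simp add: N_def card_all_edges)
  have T: "falling r N m > 0" using m N by (intro falling_pos) (auto simp: N_def)
  define F where "F = {..<n} \<rightarrow>\<^sub>E {..<q}"
  have F: "finite F" "card F = q ^ n" by (auto simp: F_def finite_PiE card_PiE)
  define B where "B c = {e \<in> all_edges n. \<not> (\<exists>u v. e = {u, v} \<and> c u = c v)}" for c :: "nat \<Rightarrow> nat"
  have finB: "finite (B c)" for c using finite_all_edges by (auto simp: B_def)
  have "{s \<in> edge_lists r (all_edges n) m. q_colorable q n (set s)} \<subseteq> (\<Union>c\<in>F. edge_lists r (B c) m)"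
  proof
    fix s assume s: "s \<in> {s \<in> edge_lists r (all_edges n) m. q_colorable q n (set s)}"
    then obtain c where c: "\<forall>v<n. c v < q" "\<And>u v. {u, v} \<in> set s \<Longrightarrow> c u \<noteq> c v"
      by (auto simp: q_colorable_def)
    have sub: "set s \<subseteq> all_edges n" using s by (auto simp: edge_lists_def)
    \<comment> \<open>Colorings are functions on all naturals; restriction leaves finitely many and
      keeps the colors at the ends of edges.\<close>
    have "restrict c {..<n} \<in> F" using c(1) by (auto simp: F_def)
    moreover have "set s \<subseteq> B (restrict c {..<n})"
    proof
      fix e assume e: "e \<in> set s"
      have "restrict c {..<n} u \<noteq> restrict c {..<n} v" if "e = {u, v}" for u v
        using that e sub c(2)[of u v] by (auto simp: all_edges_def)
      then show "e \<in> B (restrict c {..<n})" using e sub by (auto simp: B_def)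
    qed
    ultimately show "s \<in> (\<Union>c\<in>F. edge_lists r (B c) m)" using s by (auto simp: edge_lists_def)
  qed
  then have "card {s \<in> edge_lists r (all_edges n) m. q_colorable q n (set s)}
      \<le> card (\<Union>c\<in>F. edge_lists r (B c) m)"
    using F(1) finB by (intro card_mono finite_UN_I finite_edge_lists)
  also have "\<dots> \<le> (\<Sum>c\<in>F. card (edge_lists r (B c) m))" by (rule card_UN_le[OF F(1)])
  finally have "real (card {s \<in> edge_lists r (all_edges n) m. q_colorable q n (set s)})
      \<le> (\<Sum>c\<in>F. real (card (edge_lists r (B c) m)))"
    unfolding of_nat_sum[symmetric] by (rule of_nat_mono)
  also have "\<dots> \<le> (\<Sum>c\<in>F. (1 - \<gamma>) ^ m * falling r N m)"
  proof (intro sum_mono)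
    fix c assume "c \<in> F"
    then have "c \<in> {..<n} \<rightarrow> {..<q}" by (auto simp: F_def)
    define D where "D = {e \<in> all_edges n. \<exists>u v. e = {u, v} \<and> c u = c v}"
    have D: "real (card D) \<ge> real N * \<gamma>"
      using card_monochromatic[OF q n \<open>c \<in> {..<n} \<rightarrow> {..<q}\<close>] by (simp add: D_def N_def \<gamma>_def)
    have "B c = all_edges n - D" "D \<subseteq> all_edges n" by (auto simp: B_def D_def)
    then have "card D + card (B c) = N"
      using finite_all_edges cardN by (metis card_Diff_subset card_mono finite_subset le_add_diff_inverse)
    then have Bc: "real (card (B c)) \<le> (1 - \<gamma>) * real N" "card (B c) \<le> N"
      using D by (auto simp: algebra_simps)
    have "real (card (edge_lists r (B c) m)) = falling r (card (B c)) m"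
      by (rule card_edge_lists[OF finB])
    also have "\<dots> \<le> (real (card (B c)) / real N) ^ m * falling r N m"
    proof (rule falling_le_power)
      show "falling r (real (card (B c))) k \<ge> 0" for k
        using card_edge_lists[OF finB, of r c k] by (metis of_nat_0_le_iff)
    qed (use m Bc N_def in auto)
    also have "\<dots> \<le> (1 - \<gamma>) ^ m * falling r N m"
      using Bc N T by (intro mult_right_mono power_mono) (auto simp: field_simps)
    finally show "real (card (edge_lists r (B c) m)) \<le> (1 - \<gamma>) ^ m * falling r N m" .
  qed
  also have "\<dots> = real q ^ n * (1 - \<gamma>) ^ m * falling r N m" by (simp add: F)
  finally have "real (card {s \<in> edge_lists r (all_edges n) m. q_colorable q n (set s)})
      \<le> real q ^ n * (1 - \<gamma>) ^ m * falling r N m" .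
  moreover have "(\<Sum>s\<in>edge_lists r (all_edges n) m. of_bool (q_colorable q n (set s))) =
      real (card {s \<in> edge_lists r (all_edges n) m. q_colorable q n (set s)})"
    using finite_edge_lists[OF finite_all_edges] by (simp add: sum_of_bool_eq Int_def)
  ultimately show ?thesis
    unfolding list_prob_def using T by (simp add: divide_le_eq N_def \<gamma>_def)
qed

section \<open>The two models as uniform sequences\<close>

text \<open>Every set of \<open>m\<close> edges underlies exactly \<open>fact m\<close> distinct
  sequences, so averages over sets and over sequences agree.\<close>

lemma prob_colorable_without_replacement:
  assumes "m \<le> n choose 2"
  shows "prob_colorable random_graph_without_replacement q n m = list_prob False q n m"
proof -
  define N where "N = n choose 2"
  define \<E> where "\<E> = {E. E \<subseteq> all_edges n \<and> card E = m}"
  define L where "L = edge_lists False (all_edges n) m"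
  have cardN: "card (all_edges n) = N" by (simp add: N_def card_all_edges)
  have fin: "finite \<E>" "finite L" using finite_all_edges
    by (auto simp: \<E>_def L_def finite_edge_lists)
  have fib: "card {s \<in> L. set s = E} = fact m" if "E \<in> \<E>" for E
  proof -
    have "finite E" using that finite_all_edges by (auto simp: \<E>_def intro: finite_subset)
    have "{s \<in> L. set s = E} = permutations_of_set E"
      using that by (auto simp: L_def \<E>_def edge_lists_def permutations_of_set_def distinct_card)
    then show ?thesis using that \<open>finite E\<close> by (simp add: \<E>_def)
  qed
  have sum: "(\<Sum>s\<in>L. h (set s)) = fact m * (\<Sum>E\<in>\<E>. h E)" for h :: "nat set set \<Rightarrow> real"
  proof -
    have "(\<Sum>s\<in>L. h (set s)) = (\<Sum>E\<in>\<E>. \<Sum>s\<in>{s \<in> L. set s = E}. h (set s))"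
      using fin by (intro sum.group[symmetric])
        (auto simp: L_def \<E>_def edge_lists_def distinct_card)
    also have "\<dots> = (\<Sum>E\<in>\<E>. fact m * h E)" by (intro sum.cong refl) (simp add: fib)
    finally show ?thesis by (simp add: sum_distrib_left)
  qed
  have total: "falling False N m = fact m * real (card \<E>)"
    using sum[of "\<lambda>_. 1"] card_edge_lists[OF finite_all_edges, of False n m] by (simp add: L_def cardN)
  have ne: "\<E> \<noteq> {}"
  proof -
    have "card \<E> = N choose m" unfolding \<E>_def using n_subsets[OF finite_all_edges] cardN by simp
    then show ?thesis using assms by (auto simp: N_def)
  qed
  have "prob_colorable random_graph_without_replacement q n m =
      real (card (\<E> \<inter> {E. q_colorable q n E})) / real (card \<E>)"
    unfolding prob_colorable_def random_graph_without_replacement_def \<E>_def[symmetric]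
    by (rule measure_pmf_of_set[OF ne fin(1)])
  also have "\<dots> = (\<Sum>E\<in>\<E>. of_bool (q_colorable q n E)) / real (card \<E>)"
    using fin by (simp add: sum_of_bool_eq)
  also have "\<dots> = list_prob False q n m"
    unfolding list_prob_def L_def[symmetric] N_def[symmetric] total sum[of "\<lambda>E. of_bool (q_colorable q n E)"] by simp
  finally show ?thesis .
qed

text \<open>Splitting by the first entry gives disjoint parts of equal size, so a uniform choice
  from their union is a uniform choice of part and then of tail.\<close>

lemma replicate_pmf_of_set:
  assumes "finite A" "A \<noteq> {}"
  shows "replicate_pmf m (pmf_of_set A) = pmf_of_set {xs. set xs \<subseteq> A \<and> length xs = m}"
proof (induction m)
  case 0
  have "{xs. set xs \<subseteq> A \<and> length xs = 0} = {[]}" by auto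
  then show ?case by (simp add: pmf_of_set_singleton)
next
  case (Suc m)
  define L where "L = {xs. set xs \<subseteq> A \<and> length xs = m}"
  have L: "finite L" "L \<noteq> {}"
  proof -
    show "finite L" unfolding L_def using assms(1) by (rule finite_lists_length_eq)
    obtain a where "a \<in> A" using assms(2) by auto
    then have "replicate m a \<in> L" by (auto simp: L_def)
    then show "L \<noteq> {}" by auto
  qed
  have eq: "{xs. set xs \<subseteq> A \<and> length xs = Suc m} = (\<Union>x\<in>A. (#) x ` L)"
    by (auto simp: L_def length_Suc_conv)
  have "pmf_of_set (\<Union>x\<in>A. (#) x ` L) = pmf_of_set A \<bind> (\<lambda>x. pmf_of_set ((#) x ` L))"
    using assms L by (intro pmf_of_set_UN[where n = "card L"])
      (auto simp: card_image disjoint_family_on_def)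
  also have "\<dots> = pmf_of_set A \<bind> (\<lambda>x. map_pmf ((#) x) (pmf_of_set L))"
    using L by (subst map_pmf_of_set_inj) auto
  finally show ?case using Suc by (simp add: eq L_def map_pmf_def)
qed

lemma prob_colorable_with_replacement:
  assumes "n \<ge> 2"
  shows "prob_colorable random_graph_with_replacement q n m = list_prob True q n m"
proof -
  define N where "N = n choose 2"
  define L where "L = edge_lists True (all_edges n) m"
  have cardN: "card (all_edges n) = N" by (simp add: N_def card_all_edges)
  have N: "N > 0" using assms by (simp add: N_def zero_less_binomial)
  then have ne: "all_edges n \<noteq> {}" using cardN by auto
  have L: "{xs. set xs \<subseteq> all_edges n \<and> length xs = m} = L" by (auto simp: L_def edge_lists_def)
  have cL: "real (card L) = falling True N m"
    using card_edge_lists[OF finite_all_edges, of True n m] by (simp add: L_def cardN)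
  moreover have "falling True N m > 0" using N by (simp add: falling_def)
  ultimately have "L \<noteq> {}" by auto
  have "finite L" unfolding L_def by (intro finite_edge_lists finite_all_edges)
  have "prob_colorable random_graph_with_replacement q n m =
      measure_pmf.prob (pmf_of_set L) {s. q_colorable q n (set s)}"
    by (simp add: prob_colorable_def random_graph_with_replacement_def
        replicate_pmf_of_set[OF finite_all_edges ne] L vimage_def)
  also have "\<dots> = real (card (L \<inter> {s. q_colorable q n (set s)})) / real (card L)"
    by (rule measure_pmf_of_set) fact+
  also have "\<dots> = list_prob True q n m"
    unfolding list_prob_def L_def[symmetric] cL N_def[symmetric] using \<open>finite L\<close> by (simp add: sum_of_bool_eq)
  finally show ?thesis .
qed

section \<open>From the step bound to the width\<close>

text \<open>The drop telescopes from the index just before the threshold for \<open>b\<close>, where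
  \<open>p\<close> still exceeds \<open>b\<close>, to the threshold for \<open>a\<close>. Starting
  one index early is the \<open>+ 1\<close>.\<close>

lemma threshold_gap:
  fixes p :: "nat \<Rightarrow> real"
  assumes start: "p 0 > b" and "a \<le> b" and stop: "p M \<le> a"
    and step: "\<And>m. m < M \<Longrightarrow> p m - p (Suc m) \<le> \<kappa>"
  shows "b - a \<le> (real (LEAST m. p m \<le> a) - real (LEAST m. p m \<le> b) + 1) * \<kappa>"
proof -
  define S where "S = (LEAST m. p m \<le> a)"
  define L where "L = (LEAST m. p m \<le> b)"
  have S: "p S \<le> a" "S \<le> M" unfolding S_def using stop by (auto intro: LeastI Least_le)
  have L: "p L \<le> b" "L \<le> S" unfolding L_def using S(1) assms(2) by (auto intro: LeastI Least_le order_trans)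
  have "L \<noteq> 0" using L(1) start by (metis linorder_not_less)
  then obtain k where k: "L = Suc k" using not0_implies_Suc by blast
  have "p k > b" using not_less_Least[of k "\<lambda>m. p m \<le> b"] k by (simp add: L_def[symmetric])
  then have "b - a \<le> p k - p S" using S by simp
  also have "\<dots> = (\<Sum>i\<in>{k..<S}. p i - p (Suc i))"
    using sum_Suc_diff'[of k S "\<lambda>i. - p i"] L k by simp
  also have "\<dots> \<le> (\<Sum>i\<in>{k..<S}. \<kappa>)" using S step by (intro sum_mono) auto
  also have "\<dots> = (real S - real L + 1) * \<kappa>" using L k by (simp add: of_nat_diff)
  finally show ?thesis by (simp add: S_def L_def)
qed

lemma list_prob_0:
  assumes "q \<ge> 1"
  shows "list_prob r q n 0 = 1"
proof -
  have "q_colorable q n {}" using assms unfolding q_colorable_def by (intro exI[of _ "\<lambda>_. 0"]) auto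
  then show ?thesis by (simp add: list_prob_def)
qed

text \<open>Up to \<open>K * n\<close> edges the probability falls from 1 to at most \<epsilon> in
  steps of order \<open>1 / sqrt n\<close>; \<open>r\<close> selects the model that \<open>G\<close>
  realizes.\<close>

lemma width_bound:
  fixes G :: "nat \<Rightarrow> nat \<Rightarrow> nat set set pmf" and r :: bool
  assumes q: "q \<ge> 2" and \<epsilon>: "0 < \<epsilon>" "\<epsilon> < 1 / 2"
    and G: "\<And>n m. 2 \<le> n \<Longrightarrow> m \<le> n choose 2 \<Longrightarrow> prob_colorable G q n m = list_prob r q n m"
  shows "\<exists>c>0. \<forall>\<^sub>F n in sequentially. characteristic_width G q \<epsilon> n \<ge> c * sqrt (real n)"
proof -
  define \<gamma> where "\<gamma> = 1 / (2 * (real q)\<^sup>2)"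
  \<comment> \<open>Makes \<open>\<gamma> * real K \<ge> ln (real q) + 1\<close>, so that the first
    moment bound at \<open>K * n\<close> edges is at most \<open>exp (- real n)\<close>.\<close>
  define K where "K = nat \<lceil>(ln (real q) + 1) / \<gamma>\<rceil>"
  define H where "H = (144 * real K + 122) * exp (16 * real K)"
  have \<gamma>: "0 < \<gamma>" "\<gamma> \<le> 1"
  proof -
    have "1 \<le> (real q)\<^sup>2" using q by (intro one_le_power) auto
    then have "1 \<le> 2 * (real q)\<^sup>2" by linarith
    then show "0 < \<gamma>" "\<gamma> \<le> 1"
      unfolding \<gamma>_def using q by (auto intro!: divide_le_eq_1_pos[THEN iffD2])
  qed
  have lnq: "ln (real q) \<ge> 0" using q by simp
  have K: "real K \<ge> (ln (real q) + 1) / \<gamma>" unfolding K_def by (rule real_nat_ceiling_ge)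
  then have K\<gamma>: "\<gamma> * real K \<ge> ln (real q) + 1" using \<gamma> by (simp add: field_simps)
  have "0 < (ln (real q) + 1) / \<gamma>" using \<gamma> lnq by (intro divide_pos_pos) auto
  then have "real K > 0" using K by linarith
  then have K1: "K \<ge> 1" by simp
  have H: "H > 0" unfolding H_def by (intro mult_pos_pos add_nonneg_pos) auto
  \<comment> \<open>The 2 before \<open>H\<close> pays for the \<open>+ 1\<close> of
    \<open>threshold_gap\<close> once \<open>c * sqrt (real n) \<ge> 1\<close>.\<close>
  define c where "c = (1 - 2 * \<epsilon>) / (2 * H)"
  have c: "c > 0" using \<epsilon> H by (simp add: c_def)
  have "\<forall>\<^sub>F n in sequentially. 100 * K \<le> n \<and> 2 * q \<le> n \<and> exp (- real n) \<le> \<epsilon> \<and> 1 \<le> c * sqrt (real n)"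
  proof (intro eventually_conj)
    show "\<forall>\<^sub>F n in sequentially. exp (- real n) \<le> \<epsilon>"
    proof (rule eventually_sequentiallyI[of "nat \<lceil>- ln \<epsilon>\<rceil>"])
      fix n assume "nat \<lceil>- ln \<epsilon>\<rceil> \<le> n"
      then have "- real n \<le> ln \<epsilon>" by linarith
      then show "exp (- real n) \<le> \<epsilon>" using \<epsilon> by (simp add: ln_ge_iff)
    qed
    show "\<forall>\<^sub>F n in sequentially. 1 \<le> c * sqrt (real n)"
    proof (rule eventually_sequentiallyI[of "nat \<lceil>(1 / c)\<^sup>2\<rceil>"])
      fix n assume "nat \<lceil>(1 / c)\<^sup>2\<rceil> \<le> n"
      then have "(1 / c)\<^sup>2 \<le> real n" by linarith
      then have "1 / c \<le> sqrt (real n)" by (rule real_le_rsqrt)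
      then show "1 \<le> c * sqrt (real n)" using c by (simp add: field_simps)
    qed
  qed (auto intro: eventually_ge_at_top)
  then have "\<forall>\<^sub>F n in sequentially. characteristic_width G q \<epsilon> n \<ge> c * sqrt (real n)"
  proof eventually_elim
    case (elim n)
    have n2: "2 \<le> n" using elim q by linarith
    \<comment> \<open>Keeps all edge numbers up to \<open>K * n\<close> in the range where
      \<open>G\<close> agrees with \<open>list_prob\<close>.\<close>
    have KN: "K * n \<le> n choose 2"
    proof -
      have "K * n * 2 \<le> n * (n - 1)"
      proof -
        have "2 * K \<le> n - 1" using elim K1 by linarith
        then have "n * (2 * K) \<le> n * (n - 1)" by (rule mult_le_mono2)
        then show ?thesis by (simp only: mult_ac)
      qed
      then show ?thesis unfolding choose_two by linarith
    qed
    have eq: "prob_colorable G q n m = list_prob r q n m" if "m \<le> K * n" for m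
      using that KN n2 by (intro G) auto
    have "1 - \<epsilon> - \<epsilon> \<le> (real (LEAST m. prob_colorable G q n m \<le> \<epsilon>)
        - real (LEAST m. prob_colorable G q n m \<le> 1 - \<epsilon>) + 1) * (H / sqrt (real n))"
    proof (rule threshold_gap[where M = "K * n"])
      show "1 - \<epsilon> < prob_colorable G q n 0" using q \<epsilon> by (simp add: eq list_prob_0)
      show "\<epsilon> \<le> 1 - \<epsilon>" using \<epsilon> by simp
      show "prob_colorable G q n m - prob_colorable G q n (Suc m) \<le> H / sqrt (real n)" if "m < K * n" for m
        using that list_prob_step[of q K n m r] q K1 elim by (simp add: eq H_def)
      have "prob_colorable G q n (K * n) \<le> real q ^ n * (1 - \<gamma>) ^ (K * n)"
        using list_prob_first_moment[of q n "K * n" r] q elim KN by (simp add: eq \<gamma>_def)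
      also have "\<dots> \<le> exp (ln (real q)) ^ n * exp (- \<gamma>) ^ (K * n)"
        using exp_ge_add_one_self[of "- \<gamma>"] q \<gamma> by (intro mult_mono power_mono) auto
      also have "\<dots> = exp (real n * (ln (real q) - \<gamma> * real K))"
        by (simp add: exp_of_nat_mult[symmetric] exp_add[symmetric] algebra_simps del: exp_ln)
      also have "\<dots> \<le> exp (real n * (- 1))"
        using K\<gamma> by (subst exp_le_cancel_iff, intro mult_left_mono) auto
      also have "\<dots> \<le> \<epsilon>" using elim by simp
      finally show "prob_colorable G q n (K * n) \<le> \<epsilon>" .
    qed
    then have "1 - 2 * \<epsilon> \<le> (characteristic_width G q \<epsilon> n + 1) * (H / sqrt (real n))"
      by (simp add: characteristic_width_def colorability_threshold_def)
    then have "2 * (c * sqrt (real n)) \<le> characteristic_width G q \<epsilon> n + 1"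
      using H n2 by (simp add: c_def field_simps)
    then show ?case using elim by linarith
  qed
  with c show ?thesis by blast
qed

theorem corollary6:
  fixes q :: nat and \<epsilon> :: real
  assumes "q \<ge> 3" and "0 < \<epsilon>" and "\<epsilon> < 1 / 2"
  shows "(\<exists>c>0. \<forall>\<^sub>F n in sequentially.
            characteristic_width random_graph_without_replacement q \<epsilon> n \<ge> c * sqrt (real n)) \<and>
         (\<exists>c>0. \<forall>\<^sub>F n in sequentially.
            characteristic_width random_graph_with_replacement q \<epsilon> n \<ge> c * sqrt (real n))"
proof
  show "\<exists>c>0. \<forall>\<^sub>F n in sequentially.
      characteristic_width random_graph_without_replacement q \<epsilon> n \<ge> c * sqrt (real n)"
    using assms by (intro width_bound[where r = False] prob_colorable_without_replacement) auto
  show "\<exists>c>0. \<forall>\<^sub>F n in sequentially.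
      characteristic_width random_graph_with_replacement q \<epsilon> n \<ge> c * sqrt (real n)"
    using assms by (intro width_bound[where r = True] prob_colorable_with_replacement) auto
qed

end
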